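(* Let $p$ be a prime and for $1\le d\le p-1$ let \[ S(d)=\mathop{\sum_{a=1}^{p-1}\sum_{b=1}^{p-1}}_{ab\equiv d\pmod p} ab. \] Then \[ \sum_{d=1}^{p-1}\Bigl|S(d)-\frac{p^2(p-1)}{4}\Bigr|^2=\frac{5}{144}\,\frac{p^2(p^2-1)^3}{p^2+1}+O\bigl(p^5 e^{3\log p/\log\log p}\bigr), \] where the implied constant is absolute.
   Context: $f=O(g)$ means $|f|\le Cg$ for some constant $C>0$. *)

theory Defs
  imports Complex_Main "HOL-Number_Theory.Cong" "HOL-Computational_Algebra.Primes"
begin

definition S :: "nat \<Rightarrow> nat \<Rightarrow> nat" where
  "S p d = (\<Sum>(a, b) | a \<in> {1..p - 1} \<and> b \<in> {1..p - 1} \<and> [a * b = d] (mod p). a * b)"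

end

theory Submission
  imports Defs "HOL-Analysis.Analysis" "HOL-Real_Asymp.Real_Asymp"
begin

text \<open>
  Let \<open>B a = (a mod p) / p - 1 / 2\<close>. Then \<open>S p d - p\<^sup>2 (p - 1) / 4\<close> is \<open>p\<^sup>2\<close> times the sum of
  \<open>B a B b\<close> over \<open>a b \<equiv> d\<close>, so the left-hand side is \<open>p\<^sup>4\<close> times the sum of \<open>B k B l B m B n\<close> over
  \<open>k l \<equiv> m n (mod p)\<close>. That quadruple sum is also the second moment of the Dedekind sums
  \<open>\<Sum>a. B a B (h a)\<close>, and the finite Fourier expansion of \<open>B\<close> turns these into cotangent sums; hence
  the left-hand side equals \<open>p\<^sup>2 / 16\<close> times the same quadruple sum for \<open>k \<mapsto> cot (\<pi> k / p)\<close>.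

  With representatives \<open>\<bar>k\<bar> < p / 2\<close> the cotangent is \<open>p / (\<pi> k) + O(1)\<close>. The solutions of \<open>k l = m n\<close>
  give the main term \<open>8 (p / \<pi>)\<^sup>4 \<zeta>(2)\<^sup>4 / \<zeta>(4)\<close>, by the parametrisation
  \<open>(k, l, m, n) = (g a, h b, g b, h a)\<close> with \<open>a, b\<close> coprime. For the remaining solutions the inequality
  \<open>1 / \<bar>u v\<bar> \<le> (1 / \<bar>u\<bar> + 1 / \<bar>v\<bar>) / \<bar>u - v\<bar>\<close> with \<open>u = k l\<close>, \<open>v = m n\<close>, \<open>p dvd u - v\<close> saves a factor \<open>p\<close>
  up to logarithms and one divisor function of an integer below \<open>p\<^sup>2\<close>, which the classical bound for
  the divisor function absorbs into \<open>exp (3 log p / log log p)\<close>.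
\<close>

section \<open>Values of the zeta function at 2 and 4\<close>

text \<open>The bounds are uniform in the number of factors. With \<open>y k = x^4 / k^4\<close> the
  error \<open>(sum y A)^2\<close> is of order x^8, small enough to isolate the coefficient of x^4
  in an infinite product.\<close>

lemma prod_one_minus_bounds:
  fixes y :: "'a \<Rightarrow> real"
  assumes "finite A" and "\<And>i. i \<in> A \<Longrightarrow> 0 \<le> y i \<and> y i \<le> 1"
  shows "1 - sum y A \<le> (\<Prod>i\<in>A. 1 - y i) \<and> (\<Prod>i\<in>A. 1 - y i) \<le> 1 - sum y A + (sum y A)\<^sup>2"
  using assms
proof (induction A rule: finite_induct)
  case empty
  then show ?case by simp
next
  case (insert i A)
  define s where "s = sum y A"
  define P where "P = (\<Prod>i\<in>A. 1 - y i)"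
  have y: "0 \<le> y i" "y i \<le> 1" and s0: "s \<ge> 0"
    using insert.prems unfolding s_def by (auto intro: sum_nonneg)
  have IH: "1 - s \<le> P" "P \<le> 1 - s + s\<^sup>2"
    using insert unfolding s_def P_def by auto
  have "(1 - y i) * (1 - s) \<le> (1 - y i) * P" "(1 - y i) * P \<le> (1 - y i) * (1 - s + s\<^sup>2)"
    using IH y by (auto intro!: mult_left_mono)
  moreover have "(1 - y i) * (1 - s) \<ge> 1 - (y i + s)"
    using mult_nonneg_nonneg[OF y(1) s0] by (simp add: algebra_simps)
  moreover have "(1 - y i) * (1 - s + s\<^sup>2) \<le> 1 - (y i + s) + (y i + s)\<^sup>2"
    using mult_nonneg_nonneg[OF y(1) s0] mult_nonneg_nonneg[OF y(1) zero_le_power2[of s]] zero_le_power2[of "y i"]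
    by (simp add: algebra_simps power2_eq_square)
  ultimately show ?case
    using insert.hyps unfolding s_def P_def by simp
qed

text \<open>This is Euler's product for the sine at an imaginary argument, where the sign in every
  factor flips.\<close>

lemma sinh_product_formula:
  assumes "x \<noteq> (0::real)"
  shows "(\<lambda>n. \<Prod>k=1..n. 1 + x\<^sup>2 / (real k)\<^sup>2) \<longlonglongrightarrow> sinh (pi * x) / (pi * x)"
proof -
  have "(\<lambda>n. of_real pi * (\<i> * of_real x) * (\<Prod>k=1..n. 1 - (\<i> * of_real x)^2 / of_nat k^2)) \<longlonglongrightarrow> sin (of_real pi * (\<i> * of_real x))"
    by (rule sin_product_formula_complex)
  also have "(\<lambda>n. of_real pi * (\<i> * of_real x) * (\<Prod>k=1..n. 1 - (\<i> * of_real x)^2 / of_nat k^2))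
     = (\<lambda>n. \<i> * of_real (pi * x * (\<Prod>k=1..n. 1 + x\<^sup>2 / (real k)\<^sup>2)))"
    by (simp add: power_mult_distrib mult_ac)
  also have "sin (of_real pi * (\<i> * of_real x)) = \<i> * of_real (sinh (pi * x))"
  proof -
    have "sin (of_real pi * (\<i> * of_real x)) = sin (\<i> * of_real (pi * x))"
      by (simp add: mult_ac)
    also have "\<dots> = \<i> * sinh (of_real (pi * x))"
      by (simp add: sinh_conv_sin)
    also have "sinh (complex_of_real (pi * x)) = of_real (sinh (pi * x))"
      by (simp add: sinh_def exp_of_real scaleR_conv_of_real
            flip: of_real_minus of_real_mult del: of_real_mult of_real_minus)
    finally show ?thesis .
  qed
  finally have "(\<lambda>n. (-\<i>) * (\<i> * complex_of_real (pi * x * (\<Prod>k=1..n. 1 + x\<^sup>2 / (real k)\<^sup>2)))) \<longlonglongrightarrow> (-\<i>) * (\<i> * of_real (sinh (pi * x)))"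
    by (rule tendsto_mult_left)
  then have "(\<lambda>n. complex_of_real (pi * x * (\<Prod>k=1..n. 1 + x\<^sup>2 / (real k)\<^sup>2))) \<longlonglongrightarrow> of_real (sinh (pi * x))"
    by (simp flip: mult.assoc)
  then have "(\<lambda>n. pi * x * (\<Prod>k=1..n. 1 + x\<^sup>2 / (real k)\<^sup>2)) \<longlonglongrightarrow> sinh (pi * x)"
    by (subst (asm) tendsto_of_real_iff)
  from tendsto_divide[OF this tendsto_const[of "pi * x"]] show ?thesis
    using assms by simp
qed

definition zeta2_sum :: "nat \<Rightarrow> real" where
  "zeta2_sum n = (\<Sum>k=1..n. 1 / (real k)\<^sup>2)"

definition zeta4_sum :: "nat \<Rightarrow> real" where
  "zeta4_sum n = (\<Sum>k=1..n. 1 / (real k) ^ 4)"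

lemma zeta2_sum_limit: "zeta2_sum \<longlonglongrightarrow> pi\<^sup>2 / 6"
proof -
  have "(\<lambda>n. \<Sum>i<n. 1 / (real i + 1)\<^sup>2) \<longlonglongrightarrow> pi\<^sup>2 / 6"
    using inverse_squares_sums by (simp add: sums_def add_ac)
  moreover have "(\<Sum>i<n. 1 / (real i + 1)\<^sup>2) = zeta2_sum n" for n
    unfolding zeta2_sum_def by (induction n) (simp_all add: add_ac)
  ultimately show ?thesis by simp
qed

lemma zeta2_sum_mono: "mono zeta2_sum"
  unfolding mono_def zeta2_sum_def by (auto intro!: sum_mono2)

lemma zeta2_sum_le: "zeta2_sum n \<le> pi\<^sup>2 / 6"
  using incseq_le[OF zeta2_sum_mono zeta2_sum_limit] .

lemma zeta2_sum_nonneg: "zeta2_sum n \<ge> 0"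
  unfolding zeta2_sum_def by (auto intro!: sum_nonneg)

text \<open>Since \<open>1 / (m + 1)^2 + 1 / (m + 1) <= 1 / m\<close>, the quantity
  \<open>zeta2_sum m + 1 / m\<close> decreases, so the tail beyond n is at most 1/n. The weaker
  \<open>2 / (n + 1)\<close> also holds at \<open>n = 0\<close>, where \<open>1 / real n\<close>
  would take the default value 0.\<close>

lemma zeta2_sum_ge: "zeta2_sum n \<ge> pi\<^sup>2 / 6 - 2 / (real n + 1)"
proof -
  have step: "zeta2_sum m + 1 / real m \<le> zeta2_sum n + 1 / real n" if "m \<ge> n" "n \<ge> 1" for m n
    using that
  proof (induction m rule: dec_induct)
    case (step m)
    have "1 / (real m + 1)\<^sup>2 + 1 / (real m + 1) \<le> 1 / real m"
      using step by (simp add: divide_simps power2_eq_square) (simp add: algebra_simps)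
    with step show ?case
      by (simp add: zeta2_sum_def add_ac)
  qed simp
  have bound: "zeta2_sum m \<le> zeta2_sum n + 2 / (real n + 1)" if "m \<ge> max 1 n" for m
  proof (cases "n = 0")
    case True
    have "zeta2_sum m + 1 / real m \<le> zeta2_sum 1 + 1"
      using step[of 1 m] that by simp
    moreover have "zeta2_sum 1 = 1" "zeta2_sum 0 + 2 / (real 0 + 1) = 2"
      by (simp_all add: zeta2_sum_def)
    moreover have "1 / real m \<ge> 0" by simp
    ultimately show ?thesis unfolding True by linarith
  next
    case False
    have "zeta2_sum m \<le> zeta2_sum m + 1 / real m" by simp
    also have "\<dots> \<le> zeta2_sum n + 1 / real n"
      using step[of n m] that False by simp
    also have "1 / real n \<le> 2 / (real n + 1)"
      using False by (simp add: divide_simps)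
    finally show ?thesis by simp
  qed
  have "pi\<^sup>2 / 6 \<le> zeta2_sum n + 2 / (real n + 1)"
    using zeta2_sum_limit
    by (rule LIMSEQ_le_const2) (use bound in blast)
  then show ?thesis by simp
qed

lemma pi_squared_le: "pi\<^sup>2 \<le> 16"
  using power_mono[of pi 4 2] pi_less_4 by simp

text \<open>The product formulas for \<open>sin\<close> and \<open>sinh\<close> multiply to \<open>\<Prod>(1 - x\<^sup>4 / k\<^sup>4)\<close>;
  the value is read off from the coefficient of \<open>x\<^sup>4\<close> at \<open>0\<close>.\<close>

lemma zeta4_sum_limit: "zeta4_sum \<longlonglongrightarrow> pi ^ 4 / 90"
proof -
  have mono: "mono zeta4_sum"
    unfolding mono_def zeta4_sum_def by (auto intro!: sum_mono2)
  have le: "zeta4_sum n \<le> zeta2_sum n" for n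
    unfolding zeta4_sum_def zeta2_sum_def
    by (intro sum_mono divide_left_mono power_increasing) auto
  have bd: "zeta4_sum n \<le> 3" "zeta4_sum n \<ge> 0" for n
    using le[of n] zeta2_sum_le[of n] pi_squared_le by (auto simp: zeta4_sum_def intro!: sum_nonneg)
  obtain K where K: "zeta4_sum \<longlonglongrightarrow> K"
    using incseq_convergent[OF mono, of 3] bd by blast
  define F :: "real \<Rightarrow> real" where "F x = (sin (pi * x) / (pi * x)) * (sinh (pi * x) / (pi * x))" for x
  \<comment> \<open>For each finite product the error is at most
    \<open>(x^4 * zeta4_sum n)^2\<close>, and \<open>zeta4_sum n <= 3\<close> makes this
    \<open>9 * x^8\<close> for all n, so the bound survives the limit.\<close>
  have est: "\<bar>1 - F x - x ^ 4 * K\<bar> \<le> 9 * x ^ 8" if x: "0 < x" "x < 1" for x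
  proof -
    have lim: "(\<lambda>n. (\<Prod>k=1..n. 1 - x ^ 4 / real k ^ 4)) \<longlonglongrightarrow> F x"
    proof -
      have "(\<lambda>n. (\<Prod>k=1..n. 1 - x\<^sup>2 / of_nat k^2) * (\<Prod>k=1..n. 1 + x\<^sup>2 / (real k)\<^sup>2)) \<longlonglongrightarrow> F x"
        unfolding F_def using x by (intro tendsto_mult sin_product_formula_real' sinh_product_formula) auto
      also have "(\<lambda>n. (\<Prod>k=1..n. 1 - x\<^sup>2 / of_nat k^2) * (\<Prod>k=1..n. 1 + x\<^sup>2 / (real k)\<^sup>2)) = (\<lambda>n. (\<Prod>k=1..n. 1 - x ^ 4 / real k ^ 4))"
        unfolding prod.distrib[symmetric]
        by (intro ext prod.cong) (simp_all add: field_simps power2_eq_square eval_nat_numeral)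
      finally show ?thesis .
    qed
    have fin: "\<bar>1 - (\<Prod>k=1..n. 1 - x ^ 4 / real k ^ 4) - x ^ 4 * zeta4_sum n\<bar> \<le> 9 * x ^ 8" for n
    proof -
      have s: "(\<Sum>k=1..n. x ^ 4 / real k ^ 4) = x ^ 4 * zeta4_sum n"
        by (simp add: zeta4_sum_def sum_distrib_left)
      have "x ^ 4 / real k ^ 4 \<le> 1" if "k \<ge> 1" for k
      proof -
        have "x ^ 4 \<le> real k ^ 4"
          using x that by (intro power_mono) auto
        then show ?thesis using that by (simp add: divide_simps)
      qed
      then have b: "1 - x ^ 4 * zeta4_sum n \<le> (\<Prod>k=1..n. 1 - x ^ 4 / real k ^ 4)"
        "(\<Prod>k=1..n. 1 - x ^ 4 / real k ^ 4) \<le> 1 - x ^ 4 * zeta4_sum n + (x ^ 4 * zeta4_sum n)\<^sup>2"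
        using prod_one_minus_bounds[of "{1..n}" "\<lambda>k. x ^ 4 / real k ^ 4"] x unfolding s by auto
      have "(x ^ 4 * zeta4_sum n)\<^sup>2 \<le> (x ^ 4 * 3)\<^sup>2"
        using bd[of n] x by (intro power_mono mult_left_mono) auto
      also have "\<dots> = 9 * x ^ 8" by (simp add: power_mult_distrib)
      finally show ?thesis using b by simp
    qed
    have "(\<lambda>n. \<bar>1 - (\<Prod>k=1..n. 1 - x ^ 4 / real k ^ 4) - x ^ 4 * zeta4_sum n\<bar>) \<longlonglongrightarrow> \<bar>1 - F x - x ^ 4 * K\<bar>"
      by (intro tendsto_intros lim K)
    then show ?thesis
      by (rule LIMSEQ_le_const2) (use fin in blast)
  qed
  have l1: "((\<lambda>x. (1 - F x) / x ^ 4) \<longlongrightarrow> pi ^ 4 / 90) (at_right 0)"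
  proof -
    \<comment> \<open>With y = pi x the two factors of \<open>F\<close> begin 1 - y^2/6 + y^4/120
      and 1 + y^2/6 + y^4/120, so \<open>1 - F x\<close> begins with (1/36 - 1/60) y^4 =
      y^4/90.\<close>
    have "pi * (pi * pi) * inverse pi * (pi * (pi * pi) * inverse pi) / 36 -
        pi * (pi * (pi * pi)) / 60 = pi ^ 4 / 90"
      by (simp add: field_simps eval_nat_numeral)
    then show ?thesis
      unfolding F_def by real_asymp
  qed
  have l2: "((\<lambda>x. (1 - F x) / x ^ 4) \<longlongrightarrow> K) (at_right 0)"
  proof (rule Lim_transform2, rule tendsto_const)
    show "((\<lambda>x. K - (1 - F x) / x ^ 4) \<longlongrightarrow> 0) (at_right 0)"
    proof (rule Lim_null_comparison)
      have "norm (K - (1 - F x) / x ^ 4) \<le> 9 * x ^ 4" if x: "0 < x" "x < 1" for x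
      proof -
        have "K - (1 - F x) / x ^ 4 = - (1 - F x - x ^ 4 * K) / x ^ 4"
          using x by (simp add: field_simps)
        then have "norm (K - (1 - F x) / x ^ 4) = \<bar>1 - F x - x ^ 4 * K\<bar> / x ^ 4"
          using x by (simp add: abs_divide del: minus_diff_eq)
        also have "\<dots> \<le> 9 * x ^ 8 / x ^ 4"
          using est[OF x] x by (intro divide_right_mono) auto
        also have "\<dots> = 9 * x ^ 4"
          using x by (simp add: field_simps flip: power_add)
        finally show ?thesis .
      qed
      then show "\<forall>\<^sub>F x in at_right 0. norm (K - (1 - F x) / x ^ 4) \<le> 9 * x ^ 4"
        unfolding eventually_at_right_field using zero_less_one by blast
      show "((\<lambda>x::real. 9 * x ^ 4) \<longlongrightarrow> 0) (at_right 0)"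
        by real_asymp
    qed
  qed
  have "K = pi ^ 4 / 90"
    using tendsto_unique[OF _ l2 l1] by simp
  with K show ?thesis by simp
qed

section \<open>Reciprocal sums over solutions of a multiplicative equation\<close>

lemma zeta4_sum_le: "zeta4_sum n \<le> pi ^ 4 / 90"
proof -
  have "mono zeta4_sum"
    unfolding mono_def zeta4_sum_def by (auto intro!: sum_mono2)
  from incseq_le[OF this zeta4_sum_limit] show ?thesis .
qed

section \<open>Sums over coprime pairs\<close>

definition coprime_pairs :: "nat \<Rightarrow> (nat \<times> nat) set" where
  "coprime_pairs n = {(a, b). a \<in> {1..n} \<and> b \<in> {1..n} \<and> coprime a b}"

definition coprime_sum :: "nat \<Rightarrow> real" where
  "coprime_sum n = (\<Sum>(a, b)\<in>coprime_pairs n. 1 / (real a * real b)\<^sup>2)"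

lemma coprime_pairs_subset: "coprime_pairs n \<subseteq> {1..n} \<times> {1..n}"
  unfolding coprime_pairs_def by auto

lemma finite_coprime_pairs: "finite (coprime_pairs n)"
  by (rule finite_subset[OF coprime_pairs_subset]) auto

lemma coprime_sum_mono: "m \<le> n \<Longrightarrow> coprime_sum m \<le> coprime_sum n"
  unfolding coprime_sum_def
  by (intro sum_mono2 finite_coprime_pairs) (auto simp: coprime_pairs_def)

lemma coprime_sum_nonneg: "coprime_sum n \<ge> 0"
  unfolding coprime_sum_def by (intro sum_nonneg) auto

text \<open>Each pair is \<open>(g * a, g * b)\<close> with g its gcd and a, b coprime, and
  \<open>g * a <= n\<close> amounts to \<open>a <= n div g\<close>. This is the finite form of
  zeta(2)^2 being zeta(4) times the full sum over coprime pairs.\<close>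

lemma zeta2_sum_power2_eq:
  "(zeta2_sum n)\<^sup>2 = (\<Sum>g=1..n. coprime_sum (n div g) / real g ^ 4)"
proof -
  have "(zeta2_sum n)\<^sup>2 = (\<Sum>(k, m)\<in>{1..n} \<times> {1..n}. 1 / (real k * real m)\<^sup>2)"
    unfolding zeta2_sum_def power2_eq_square[of "sum _ _"] sum_product sum.cartesian_product
    by (intro sum.cong) (auto simp: power_mult_distrib)
  also have "\<dots> = (\<Sum>(g, a, b)\<in>Sigma {1..n} (\<lambda>g. coprime_pairs (n div g)). 1 / (real (g * a) * real (g * b))\<^sup>2)"
  proof (rule sum.reindex_bij_witness[where
        i = "\<lambda>(g, a, b). (g * a, g * b)" and j = "\<lambda>(k, m). (gcd k m, k div gcd k m, m div gcd k m)"], goal_cases)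
    case (1 x)
    then show ?case by auto
  next
    case (2 x)
    then obtain k m where x: "x = (k, m)" "k \<in> {1..n}" "m \<in> {1..n}" by auto
    have "coprime (k div gcd k m) (m div gcd k m)"
      using x by (intro div_gcd_coprime) auto
    moreover have "gcd k m \<le> n" "gcd k m \<ge> 1"
      using x gcd_le1_nat[of k m] order_trans[of "gcd k m" k n] by (auto simp: Suc_le_eq)
    moreover have "k div gcd k m > 0" "m div gcd k m > 0"
      using x by (auto simp: div_greater_zero_iff)
    moreover have "k div gcd k m \<le> n div gcd k m" "m div gcd k m \<le> n div gcd k m"
      using x by (auto intro: div_le_mono)
    ultimately show ?case
      by (auto simp: x coprime_pairs_def Suc_le_eq)
  next
    case (3 y)
    then show ?case by (auto simp: coprime_pairs_def gcd_mult_distrib_nat[symmetric])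
  next
    case (4 y)
    then obtain g a b where y: "y = (g, a, b)" "g \<ge> 1" "a \<ge> 1" "b \<ge> 1" "a \<le> n div g" "b \<le> n div g"
      by (auto simp: coprime_pairs_def)
    then have "g * a \<le> n" "g * b \<le> n"
      by (metis dual_order.trans mult.commute mult_le_mono1 times_div_less_eq_dividend div_times_less_eq_dividend)+
    then show ?case using y by auto
  next
    case (5 x)
    have "gcd k m * (k div gcd k m) = k" "gcd k m * (m div gcd k m) = m" for k m :: nat
      by simp_all
    then show ?case by (simp only: case_prod_beta fst_conv snd_conv)
  qed
  also have "\<dots> = (\<Sum>g=1..n. \<Sum>(a, b)\<in>coprime_pairs (n div g). 1 / (real (g * a) * real (g * b))\<^sup>2)"
    by (subst sum.Sigma) (auto simp: finite_coprime_pairs)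
  also have "\<dots> = (\<Sum>g=1..n. coprime_sum (n div g) / real g ^ 4)"
    unfolding coprime_sum_def sum_divide_distrib
    by (intro sum.cong) (auto simp: power_mult_distrib eval_nat_numeral)
  finally show ?thesis .
qed

text \<open>The two estimates below avoid Moebius inversion: \<open>5 / 2 = \<zeta>(2)\<^sup>2 / \<zeta>(4)\<close>, and the upper bound
  comes from the partial sum of order \<open>n N\<close>, in which every \<open>g \<le> N\<close> contributes at least \<open>coprime_sum n / g\<^sup>4\<close>.\<close>

lemma coprime_sum_le: "coprime_sum n \<le> 5 / 2"
proof -
  have ge: "coprime_sum n * zeta4_sum N \<le> (pi\<^sup>2 / 6)\<^sup>2" for N
  proof (cases "n = 0")
    case True
    then show ?thesis by (simp add: coprime_sum_def coprime_pairs_def)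
  next
    case False
    have "coprime_sum n * zeta4_sum N = (\<Sum>g=1..N. coprime_sum n / real g ^ 4)"
      by (simp add: zeta4_sum_def sum_distrib_left)
    also have "\<dots> \<le> (\<Sum>g=1..N. coprime_sum (n * N div g) / real g ^ 4)"
    proof (intro sum_mono divide_right_mono coprime_sum_mono)
      fix g assume g: "g \<in> {1..N}"
      have "n * N div N \<le> n * N div g" using g by (intro div_le_mono2) auto
      then show "n \<le> n * N div g" using g by simp
    qed auto
    also have "\<dots> \<le> (\<Sum>g=1..n * N. coprime_sum (n * N div g) / real g ^ 4)"
      using False by (intro sum_mono2) (auto intro!: divide_nonneg_nonneg coprime_sum_nonneg)
    also have "\<dots> = (zeta2_sum (n * N))\<^sup>2" by (rule zeta2_sum_power2_eq[symmetric])
    also have "\<dots> \<le> (pi\<^sup>2 / 6)\<^sup>2"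
      by (intro power_mono zeta2_sum_le zeta2_sum_nonneg)
    finally show ?thesis .
  qed
  have "coprime_sum n * (pi ^ 4 / 90) \<le> (pi\<^sup>2 / 6)\<^sup>2"
    by (rule LIMSEQ_le_const2[OF tendsto_mult_left[OF zeta4_sum_limit]]) (use ge in blast)
  then show ?thesis by (simp add: field_simps power_divide)
qed

lemma coprime_sum_ge: "coprime_sum n \<ge> 5 / 2 - 10 / (real n + 1)"
proof -
  have "(zeta2_sum n)\<^sup>2 \<le> (\<Sum>g=1..n. coprime_sum n / real g ^ 4)"
    unfolding zeta2_sum_power2_eq
    by (intro sum_mono divide_right_mono coprime_sum_mono) auto
  also have "\<dots> = coprime_sum n * zeta4_sum n"
    by (simp add: zeta4_sum_def sum_distrib_left)
  also have "\<dots> \<le> coprime_sum n * (pi ^ 4 / 90)"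
    by (intro mult_left_mono zeta4_sum_le coprime_sum_nonneg)
  finally have 1: "(zeta2_sum n)\<^sup>2 \<le> coprime_sum n * (pi ^ 4 / 90)" .
  define u where "u = pi\<^sup>2 / 6"
  define e where "e = 2 / (real n + 1)"
  have u: "zeta2_sum n \<ge> u - e" "zeta2_sum n \<le> u" "zeta2_sum n \<ge> 0" "u \<ge> 1" "e \<ge> 0"
    using zeta2_sum_ge[of n] zeta2_sum_le[of n] zeta2_sum_nonneg[of n] zeta2_sum_le[of 1]
    by (auto simp: u_def e_def zeta2_sum_def)
  have "u\<^sup>2 - 2 * u * e \<le> (zeta2_sum n)\<^sup>2"
  \<comment> \<open>Squaring \<open>u - e <= zeta2_sum n\<close> needs \<open>u - e >= 0\<close>;
    for \<open>e > u\<close> the left side \<open>u * (u - 2 * e)\<close> is negative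
    anyway.\<close>
  proof (cases "e \<le> u")
    case True
    then have "(u - e)\<^sup>2 \<le> (zeta2_sum n)\<^sup>2"
      using u by (intro power_mono) auto
    moreover have "(u - e)\<^sup>2 = u\<^sup>2 - 2 * u * e + e\<^sup>2"
      by (simp add: power2_eq_square algebra_simps)
    ultimately show ?thesis using zero_le_power2[of e] by linarith
  next
    case False
    then have "u * (u - 2 * e) \<le> 0"
      using u by (intro mult_nonneg_nonpos) auto
    moreover have "u * (u - 2 * e) = u\<^sup>2 - 2 * u * e"
      by (simp add: power2_eq_square algebra_simps)
    ultimately show ?thesis using zero_le_power2[of "zeta2_sum n"] by linarith
  qed
  also have "\<dots> \<le> coprime_sum n * (pi ^ 4 / 90)" by (rule 1)
  \<comment> \<open>In other words, zeta(4) is 2/5 of zeta(2)^2.\<close>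
  also have "pi ^ 4 / 90 = 2 / 5 * u\<^sup>2"
    by (simp add: u_def power_divide)
  finally have "u\<^sup>2 - 2 * u * e \<le> coprime_sum n * (2 / 5 * u\<^sup>2)" .
  then have "(u\<^sup>2 - 2 * u * e) / (2 / 5 * u\<^sup>2) \<le> coprime_sum n"
    using u by (simp add: divide_le_eq)
  moreover have "(u\<^sup>2 - 2 * u * e) / (2 / 5 * u\<^sup>2) = 5 / 2 - 5 * e / u"
    using u by (simp add: field_simps power2_eq_square)
  \<comment> \<open>\<open>u >= 1\<close> reduces the loss to \<open>5 * e\<close>, which is
    \<open>10 / (n + 1)\<close>.\<close>
  moreover have "5 * e / u \<le> 5 * e / 1"
    using u by (intro divide_left_mono) auto
  ultimately show ?thesis using u unfolding e_def by simp
qed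

section \<open>Solutions of k l = m r in positive integers\<close>

definition quadruples :: "nat \<Rightarrow> (nat \<times> nat \<times> nat \<times> nat) set" where
  "quadruples n = {(k, l, m, r). k \<in> {1..n} \<and> l \<in> {1..n} \<and> m \<in> {1..n} \<and> r \<in> {1..n} \<and> k * l = m * r}"

text \<open>Put g = gcd(k, m), k = g a, m = g b. Then a l = b r with a, b coprime, so l = h b and r
  = h a. The product of the four variables is (g h a b)^2, and the size conditions say that g and h
  range independently up to \<open>n div max a b\<close>.\<close>

lemma sum_quadruples_eq:
  "(\<Sum>(k, l, m, r)\<in>quadruples n. 1 / (real k * real l * real m * real r))
     = (\<Sum>(a, b)\<in>coprime_pairs n. (zeta2_sum (n div max a b))\<^sup>2 / (real a * real b)\<^sup>2)"
proof -
  have "(\<Sum>(a, b)\<in>coprime_pairs n. (zeta2_sum (n div max a b))\<^sup>2 / (real a * real b)\<^sup>2)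
      = (\<Sum>x\<in>coprime_pairs n. \<Sum>(g, h)\<in>{1..n div max (fst x) (snd x)} \<times> {1..n div max (fst x) (snd x)}.
          1 / (real g * real h * real (fst x) * real (snd x))\<^sup>2)"
  proof (intro sum.cong refl)
    fix x
    have "(\<Sum>(g, h)\<in>{1..N} \<times> {1..N}. 1 / (real g * real h * c * d)\<^sup>2) = (zeta2_sum N)\<^sup>2 / (c * d)\<^sup>2" for N c d
      unfolding zeta2_sum_def power2_eq_square[of "sum _ _"] sum_product sum.cartesian_product sum_divide_distrib
      by (intro sum.cong) (auto simp: power_mult_distrib)
    then show "(case x of (a, b) \<Rightarrow> (zeta2_sum (n div max a b))\<^sup>2 / (real a * real b)\<^sup>2)
        = (\<Sum>(g, h)\<in>{1..n div max (fst x) (snd x)} \<times> {1..n div max (fst x) (snd x)}.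
          1 / (real g * real h * real (fst x) * real (snd x))\<^sup>2)"
      by (simp add: case_prod_beta)
  qed
  also have "\<dots> = (\<Sum>((a, b), (g, h))\<in>Sigma (coprime_pairs n) (\<lambda>x. {1..n div max (fst x) (snd x)} \<times> {1..n div max (fst x) (snd x)}).
        1 / (real g * real h * real a * real b)\<^sup>2)"
    by (subst sum.Sigma) (auto simp: finite_coprime_pairs case_prod_beta)
  also have "\<dots> = (\<Sum>(k, l, m, r)\<in>quadruples n. 1 / (real k * real l * real m * real r))"
  proof (rule sum.reindex_bij_witness[where
        j = "\<lambda>((a, b), (g, h)). (g * a, h * b, g * b, h * a)"
        and i = "\<lambda>(k, l, m, r). ((k div gcd k m, m div gcd k m), (gcd k m, l div (m div gcd k m)))"], goal_cases)
    case (1 x)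
    then show ?case by (auto simp: coprime_pairs_def gcd_mult_distrib_nat[symmetric])
  next
    case (2 x)
    then obtain a b g h where x: "x = ((a, b), (g, h))" "a \<ge> 1" "b \<ge> 1" "g \<ge> 1" "h \<ge> 1"
        "g \<le> n div max a b" "h \<le> n div max a b"
      by (auto simp: coprime_pairs_def)
    have "g * max a b \<le> n" "h * max a b \<le> n"
      using x by (auto simp: less_eq_div_iff_mult_less_eq)
    then have "g * a \<le> n" "g * b \<le> n" "h * a \<le> n" "h * b \<le> n"
      by (meson dual_order.trans max.cobounded1 max.cobounded2 mult_le_mono2)+
    then show ?case using x by (auto simp: quadruples_def)
  next
    case (3 y)
    then obtain k l m r where y: "y = (k, l, m, r)" "k \<in> {1..n}" "l \<in> {1..n}" "m \<in> {1..n}" "r \<in> {1..n}" "k * l = m * r"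
      by (auto simp: quadruples_def)
    define g where "g = gcd k m"
    obtain a b where ab: "k = g * a" "m = g * b" "coprime a b"
      using y gcd_coprime_exists[of k m] unfolding g_def by (auto simp: mult.commute)
    have g0: "g > 0" using y ab by (cases g) auto
    have *: "a * l = b * r" using y ab g0 by auto
    then have "b dvd l" using ab(3)
      by (metis coprime_commute coprime_dvd_mult_right_iff dvd_triv_left)
    then obtain h where h: "l = b * h" by auto
    have "b > 0" using y ab by (cases b) auto
    then have r: "r = a * h" using * h by auto
    have "k div gcd k m = a" "m div gcd k m = b"
      unfolding g_def[symmetric] using ab g0 by auto
    moreover have "(gcd k m, l div b) = (g, h)"
      using h \<open>b > 0\<close> by (simp add: g_def)
    ultimately show ?case using y(1) ab(1,2) h r by (simp add: mult_ac)
  next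
    case (4 y)
    then obtain k l m r where y: "y = (k, l, m, r)" "k \<in> {1..n}" "l \<in> {1..n}" "m \<in> {1..n}" "r \<in> {1..n}" "k * l = m * r"
      by (auto simp: quadruples_def)
    define g where "g = gcd k m"
    obtain a b where ab: "k = g * a" "m = g * b" "coprime a b"
      using y gcd_coprime_exists[of k m] unfolding g_def by (auto simp: mult.commute)
    have g0: "g > 0" using y ab by (cases g) auto
    have *: "a * l = b * r" using y ab g0 by auto
    then have "b dvd l" using ab(3)
      by (metis coprime_commute coprime_dvd_mult_right_iff dvd_triv_left)
    then obtain h where h: "l = b * h" by auto
    have b0: "b > 0" using y ab by (cases b) auto
    then have r: "r = a * h" using * h by auto
    have a0: "a > 0" using y ab by (cases a) auto
    have h0: "h > 0" using y h by (cases h) auto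
    have "a \<le> g * a" "b \<le> g * b" using g0 by auto
    then have "a \<le> n" "b \<le> n" using y(2,4) ab(1,2) by (simp_all only: atLeastAtMost_iff) linarith+
    moreover have "g * max a b \<le> n" "h * max a b \<le> n"
      using y ab h r by (auto simp: max_def mult_ac)
    then have "g \<le> n div max a b" "h \<le> n div max a b"
      using a0 by (auto simp: less_eq_div_iff_mult_less_eq)
    moreover have "k div gcd k m = a" "m div gcd k m = b" "gcd k m = g" "l div b = h"
      unfolding g_def[symmetric] using ab g0 h b0 by auto
    ultimately show ?case using y(1) ab(3) g0 a0 b0 h0
      by (auto simp: coprime_pairs_def)
  next
    case (5 x)
    then show ?case by (auto simp: power2_eq_square mult_ac)
  qed
  finally show ?thesis by simp
qed

text \<open>The limit is zeta(2)^4 / zeta(4). The upper bound holds without error because every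
  truncated sum lies below its limit. In the lower bound, cutting zeta(2) off at
  \<open>n div max a b\<close> loses a multiple of (a + b) / n, and summing this against 1 / (a b)^2
  costs one harmonic factor.\<close>

lemma sum_quadruples_bound:
  assumes "n \<ge> 1"
  shows "\<bar>(\<Sum>(k, l, m, r)\<in>quadruples n. 1 / (real k * real l * real m * real r)) - 5 * pi ^ 4 / 72\<bar>
     \<le> 200 * harm n / real n"
proof -
  define u where "u = pi\<^sup>2 / 6"
  define M where "M = (\<Sum>(k, l, m, r)\<in>quadruples n. 1 / (real k * real l * real m * real r))"
  have u: "u \<ge> 1" "u \<le> 3"
    using zeta2_sum_le[of 1] pi_squared_le by (auto simp: zeta2_sum_def u_def)
  have M: "M = (\<Sum>(a, b)\<in>coprime_pairs n. (zeta2_sum (n div max a b))\<^sup>2 / (real a * real b)\<^sup>2)"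
    unfolding M_def by (rule sum_quadruples_eq)
  have h1: "harm n \<ge> (1::real)"
    using harm_mono[OF assms, where 'a = real] by (simp add: harm_expand)
  have "M \<le> (\<Sum>(a, b)\<in>coprime_pairs n. u\<^sup>2 / (real a * real b)\<^sup>2)"
    unfolding M u_def by (intro sum_mono) (auto intro!: divide_right_mono power_mono zeta2_sum_le zeta2_sum_nonneg)
  also have "\<dots> = u\<^sup>2 * coprime_sum n"
    unfolding coprime_sum_def sum_distrib_left by (simp add: case_prod_beta)
  also have "\<dots> \<le> u\<^sup>2 * (5 / 2)"
    by (intro mult_left_mono coprime_sum_le) auto
  finally have up: "M \<le> 5 * pi ^ 4 / 72"
    by (simp add: u_def power_divide)
  have est: "u\<^sup>2 / (real a * real b)\<^sup>2 - 4 * u / real n * (1 / (real a)\<^sup>2 * (1 / real b) + 1 / real a * (1 / (real b)\<^sup>2))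
        \<le> (zeta2_sum (n div max a b))\<^sup>2 / (real a * real b)\<^sup>2"
    if "(a, b) \<in> coprime_pairs n" for a b
  proof -
    have ab: "a \<ge> 1" "b \<ge> 1" using that by (auto simp: coprime_pairs_def)
    define N where "N = n div max a b"
    define z where "z = zeta2_sum N"
    have "n < (N + 1) * max a b"
      unfolding N_def using ab by (metis Suc_eq_plus1 dividend_less_div_times max.coboundedI1 add.commute mult_Suc not_less_eq_eq not_one_le_zero neq0_conv le_zero_eq)
    \<comment> \<open>Replacing the maximum by the sum lets the error split into products of
      one-variable sums in a and b.\<close>
    then have "n \<le> (N + 1) * (a + b)"
      by (meson add_increasing le_add1 le_add2 less_imp_le_nat max.bounded_iff mult_le_mono2 order_trans)
    then have "real n \<le> (real N + 1) * (real a + real b)"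
      by (metis of_nat_1 of_nat_add of_nat_le_iff of_nat_mult)
    then have "1 / (real N + 1) \<le> (real a + real b) / real n"
      using assms by (simp add: field_simps)
    moreover have "z \<ge> u - 2 / (real N + 1)"
      unfolding z_def u_def by (rule zeta2_sum_ge)
    ultimately have zl: "z \<ge> u - 2 * ((real a + real b) / real n)" by linarith
    have z: "z \<le> u" "z \<ge> 0"
      unfolding z_def u_def by (rule zeta2_sum_le, rule zeta2_sum_nonneg)
    have "u\<^sup>2 - z\<^sup>2 = (u - z) * (u + z)" by (simp add: power2_eq_square algebra_simps)
    also have "\<dots> \<le> (2 * ((real a + real b) / real n)) * (2 * u)"
      using z zl by (intro mult_mono) auto
    finally have "u\<^sup>2 - 4 * u / real n * (real a + real b) \<le> z\<^sup>2"
      by (simp add: field_simps)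
    then have "(u\<^sup>2 - 4 * u / real n * (real a + real b)) / (real a * real b)\<^sup>2 \<le> z\<^sup>2 / (real a * real b)\<^sup>2"
      by (intro divide_right_mono) auto
    moreover have "(u\<^sup>2 - 4 * u / real n * (real a + real b)) / (real a * real b)\<^sup>2
       = u\<^sup>2 / (real a * real b)\<^sup>2 - 4 * u / real n * (1 / (real a)\<^sup>2 * (1 / real b) + 1 / real a * (1 / (real b)\<^sup>2))"
      using ab assms by (simp add: divide_simps power2_eq_square)
    ultimately show ?thesis by (simp add: z_def N_def)
  qed
  have tail: "(\<Sum>(a, b)\<in>coprime_pairs n. 1 / (real a)\<^sup>2 * (1 / real b) + 1 / real a * (1 / (real b)\<^sup>2)) \<le> 6 * harm n"
  proof -
    have "(\<Sum>(a, b)\<in>coprime_pairs n. 1 / (real a)\<^sup>2 * (1 / real b) + 1 / real a * (1 / (real b)\<^sup>2))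
       \<le> (\<Sum>(a, b)\<in>{1..n} \<times> {1..n}. 1 / (real a)\<^sup>2 * (1 / real b) + 1 / real a * (1 / (real b)\<^sup>2))"
      by (intro sum_mono2 coprime_pairs_subset) auto
    also have "\<dots> = 2 * (zeta2_sum n * harm n)"
      unfolding sum.cartesian_product[symmetric] sum.distrib sum_product[symmetric]
      by (simp add: zeta2_sum_def harm_def inverse_eq_divide)
    also have "\<dots> \<le> 2 * (3 * harm n)"
      using zeta2_sum_le[of n] u h1 unfolding u_def by (intro mult_left_mono mult_right_mono) auto
    finally show ?thesis by simp
  qed
  have "u\<^sup>2 * coprime_sum n - 4 * u / real n * (\<Sum>(a, b)\<in>coprime_pairs n. 1 / (real a)\<^sup>2 * (1 / real b) + 1 / real a * (1 / (real b)\<^sup>2))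
      = (\<Sum>(a, b)\<in>coprime_pairs n. u\<^sup>2 / (real a * real b)\<^sup>2 - 4 * u / real n * (1 / (real a)\<^sup>2 * (1 / real b) + 1 / real a * (1 / (real b)\<^sup>2)))"
    unfolding coprime_sum_def sum_distrib_left sum_subtractf[symmetric] by (simp add: case_prod_beta)
  also have "\<dots> \<le> M"
    unfolding M by (intro sum_mono) (use est in auto)
  finally have 1: "u\<^sup>2 * coprime_sum n - 4 * u / real n * (\<Sum>(a, b)\<in>coprime_pairs n. 1 / (real a)\<^sup>2 * (1 / real b) + 1 / real a * (1 / (real b)\<^sup>2)) \<le> M" .
  have 2: "4 * u / real n * (\<Sum>(a, b)\<in>coprime_pairs n. 1 / (real a)\<^sup>2 * (1 / real b) + 1 / real a * (1 / (real b)\<^sup>2))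
     \<le> 4 * 3 / real n * (6 * harm n)"
    using u h1 tail by (intro mult_mono divide_right_mono) (auto intro!: sum_nonneg)
  have 3: "u\<^sup>2 * (5 / 2 - 10 / (real n + 1)) \<le> u\<^sup>2 * coprime_sum n"
    by (intro mult_left_mono coprime_sum_ge) auto
  have "u\<^sup>2 \<le> 3\<^sup>2"
    using u by (intro power_mono) auto
  then have "u\<^sup>2 * (10 / (real n + 1)) \<le> (9 * harm n) * (10 / real n)"
    using assms h1 mult_right_mono[of 1 "harm n" 9] by (intro mult_mono divide_left_mono) auto
  moreover have "u\<^sup>2 * (5 / 2 - 10 / (real n + 1)) = 5 * pi ^ 4 / 72 - u\<^sup>2 * (10 / (real n + 1))"
    by (simp add: u_def power_divide right_diff_distrib)
  \<comment> \<open>The two losses add up to 90 + 72 = 162, rounded up to 200.\<close>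
  moreover have "(9 * harm n) * (10 / real n) + 4 * 3 / real n * (6 * harm n) \<le> 200 * harm n / real n"
    using h1 assms by (simp add: field_simps)
  ultimately have "5 * pi ^ 4 / 72 - 200 * harm n / real n \<le> M"
    using 1 2 3 by linarith
  with up h1 show ?thesis unfolding M_def by simp
qed

section \<open>The divisor function\<close>

lemma card_divisors_prime_power_mult_le:
  fixes q m :: nat
  assumes "prime q" "m > 0"
  shows "card {d. d dvd q ^ a * m} \<le> (a + 1) * card {d. d dvd m}"
proof -
  have "{d. d dvd q ^ a * m} \<subseteq> (\<lambda>(i, e). q ^ i * e) ` ({..a} \<times> {d. d dvd m})"
  proof
    fix d assume "d \<in> {d. d dvd q ^ a * m}"
    then obtain b c where "d = b * c" "b dvd q ^ a" "c dvd m"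
      using division_decomp[of d "q ^ a" m] by auto
    moreover then obtain i where "i \<le> a" "b = q ^ i"
      using divides_primepow_nat[OF assms(1)] by blast
    ultimately show "d \<in> (\<lambda>(i, e). q ^ i * e) ` ({..a} \<times> {d. d dvd m})"
      by auto
  qed
  then have "card {d. d dvd q ^ a * m} \<le> card ((\<lambda>(i, e). q ^ i * e) ` ({..a} \<times> {d. d dvd m}))"
    using assms by (intro card_mono) auto
  also have "\<dots> \<le> card ({..a} \<times> {d. d dvd m})"
    using assms by (intro card_image_le) auto
  finally show ?thesis by (simp add: card_cartesian_product)
qed

text \<open>Removing a prime power \<open>q^a\<close> divides the divisor count by at most
  \<open>a + 1\<close>, to be paid for by \<open>q powr (delta * a)\<close>. For
  \<open>q >= Y\<close> this is at least 2^a, which suffices. For smaller q it is at least 1 + delta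
  a ln 2, and one factor C lifts this to at least 1 + a. So only the small primes dividing n
  contribute a C.\<close>

lemma card_divisors_le_powr:
  fixes n :: nat and \<delta> C Y :: real
  assumes n: "n > 0" and \<delta>: "\<delta> > 0"
    and C1: "C \<ge> 1" and C2: "C * (\<delta> * ln 2) \<ge> 1" and Y: "2 powr (1 / \<delta>) \<le> Y"
  shows "real (card {d. d dvd n}) \<le> real n powr \<delta> * C ^ card {q. prime q \<and> q dvd n \<and> real q < Y}"
  using n
proof (induction n rule: less_induct)
  case (less n)
  show ?case
  proof (cases "n = 1")
    case True
    then show ?thesis using C1 by simp
  next
    case False
    then obtain q where q: "prime q" "q dvd n"
      using prime_factor_nat by blast
    obtain m where m: "n = q ^ multiplicity q n * m" "\<not> q dvd m"
      using multiplicity_decompose'[of n q] less.prems q by (metis not_prime_unit neq0_conv)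
    define a where "a = multiplicity q n"
    have nam: "n = q ^ a * m" using m a_def by simp
    have m0: "m > 0" using nam less.prems by (cases m) auto
    have a1: "a > 0"
      using q m nam by (cases a) auto
    have q2: "q \<ge> 2" using q prime_ge_2_nat by blast
    have "m < n"
      using m0 a1 q2 nam one_less_power[of q a] by simp
    define X where "X k = {q. prime q \<and> q dvd k \<and> real q < Y}" for k :: nat
    have fin: "finite (X k)" if "k > 0" for k
      using that unfolding X_def by (rule_tac finite_subset[of _ "{d. d dvd k}"]) auto
    have IH: "real (card {d. d dvd m}) \<le> real m powr \<delta> * C ^ card (X m)"
      using less.IH[OF \<open>m < n\<close> m0] unfolding X_def .
    have qm: "q \<notin> X m" using m by (simp add: X_def)
    have XX: "X m \<subseteq> X n" unfolding X_def nam by auto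
    have key: "real (a + 1) * C ^ card (X m) \<le> (real q powr \<delta>) ^ a * C ^ card (X n)"
    proof (cases "real q < Y")
      case True
      have "insert q (X m) \<subseteq> X n" using XX q True by (auto simp: X_def)
      then have "card (insert q (X m)) \<le> card (X n)"
        using fin less.prems by (intro card_mono) auto
      then have le: "Suc (card (X m)) \<le> card (X n)"
        using qm fin[OF m0] by simp
      have "exp (\<delta> * ln 2 * real a) \<le> exp (\<delta> * ln (real q) * real a)"
        using q2 \<delta> by (auto intro!: mult_mono)
      also have "\<dots> = (real q powr \<delta>) ^ a"
        using q2 by (simp add: powr_def exp_of_nat_mult[symmetric] mult_ac)
      finally have "1 + \<delta> * ln 2 * real a \<le> (real q powr \<delta>) ^ a"
        using exp_ge_add_one_self[of "\<delta> * ln 2 * real a"] by linarith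
      then have "C * (1 + \<delta> * ln 2 * real a) \<le> C * (real q powr \<delta>) ^ a"
        using C1 by (intro mult_left_mono) auto
      moreover have "real a \<le> C * (\<delta> * ln 2) * real a"
        using mult_right_mono[OF C2, of "real a"] by simp
      ultimately have "real (a + 1) \<le> C * (real q powr \<delta>) ^ a"
        using C1 by (simp add: algebra_simps)
      then have "real (a + 1) * C ^ card (X m) \<le> C * (real q powr \<delta>) ^ a * C ^ card (X m)"
        using C1 by (intro mult_right_mono) auto
      also have "\<dots> = (real q powr \<delta>) ^ a * C ^ Suc (card (X m))" by simp
      also have "\<dots> \<le> (real q powr \<delta>) ^ a * C ^ card (X n)"
        using C1 le by (intro mult_left_mono power_increasing) auto
      finally show ?thesis .
    next
      case False
      have "2 = (2 powr (1 / \<delta>)) powr \<delta>"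
        using \<delta> by (simp add: powr_powr)
      also have "\<dots> \<le> real q powr \<delta>"
        using False Y \<delta> by (intro powr_mono2) auto
      finally have "2 ^ a \<le> (real q powr \<delta>) ^ a"
        by (intro power_mono) auto
      moreover have "real (a + 1) \<le> 2 ^ a"
        by (metis Suc_eq_plus1 Suc_leI less_exp of_nat_le_iff of_nat_numeral of_nat_power)
      ultimately have "real (a + 1) \<le> (real q powr \<delta>) ^ a" by linarith
      moreover have "C ^ card (X m) \<le> C ^ card (X n)"
        using C1 XX fin less.prems by (intro power_increasing card_mono) auto
      ultimately show ?thesis
        using C1 by (intro mult_mono) auto
    qed
    have "real (card {d. d dvd n}) \<le> real (a + 1) * real (card {d. d dvd m})"
      using card_divisors_prime_power_mult_le[OF q(1) m0, of a] unfolding nam of_nat_mult[symmetric] of_nat_le_iff by simp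
    also have "\<dots> \<le> real (a + 1) * (real m powr \<delta> * C ^ card (X m))"
      using IH by (intro mult_left_mono) auto
    also have "\<dots> = real m powr \<delta> * (real (a + 1) * C ^ card (X m))" by simp
    also have "\<dots> \<le> real m powr \<delta> * ((real q powr \<delta>) ^ a * C ^ card (X n))"
      using key by (intro mult_left_mono) auto
    also have "\<dots> = real n powr \<delta> * C ^ card (X n)"
      unfolding nam using q2 m0
      by (simp add: powr_mult powr_power powr_powr mult_ac flip: powr_realpow)
    finally show ?thesis unfolding X_def .
  qed
qed

text \<open>The choice \<open>\<delta> = 1 / ln (ln x)\<close> in the preceding bound, for \<open>n \<le> x\<^sup>2\<close>.\<close>

definition divisor_bound :: "real \<Rightarrow> real" where
  "divisor_bound x = x powr (2 / ln (ln x)) * (2 * ln (ln x)) powr (2 powr ln (ln x) + 1)"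

lemma card_divisors_le_divisor_bound:
  assumes x: "ln (ln x) \<ge> 1" "x > 1" and n: "n > 0" "real n \<le> x\<^sup>2"
  shows "real (card {d. d dvd n}) \<le> divisor_bound x"
proof -
  define t where "t = ln (ln x)"
  have t: "t \<ge> 1" using x by (simp add: t_def)
  have ln2: "ln 2 \<ge> (1/2::real)"
    using ln2_ge_two_thirds by simp
  define X where "X = {q. prime q \<and> q dvd n \<and> real q < 2 powr t}"
  \<comment> \<open>Here delta = 1/t, C = 2 t and Y = \<open>2 powr t\<close>; then C delta ln 2 = 2
    ln 2, which is at least 1.\<close>
  have *: "real (card {d. d dvd n}) \<le> real n powr (1 / t) * (2 * t) ^ card X"
    unfolding X_def using n t ln2
    by (intro card_divisors_le_powr) (auto simp: field_simps)
  have "real n powr (1 / t) \<le> (x\<^sup>2) powr (1 / t)"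
    using n t by (intro powr_mono2) auto
  also have "(x\<^sup>2) powr (1 / t) = x powr (2 / t)"
    using x by (simp add: powr_powr flip: powr_numeral)
  finally have **: "real n powr (1 / t) \<le> x powr (2 / t)" .
  have "(2 * t) ^ card X = (2 * t) powr real (card X)"
    using t by (simp add: powr_realpow)
  also have "\<dots> \<le> (2 * t) powr (2 powr t + 1)"
  \<comment> \<open>Counting all integers up to \<open>2 powr t\<close> in place of primes is
    enough: for t = ln (ln x) this is (ln x)^(ln 2), a power of ln x with exponent below 1.\<close>
  proof (rule powr_mono)
    have "X \<subseteq> {..nat \<lfloor>2 powr t\<rfloor>}"
      unfolding X_def by (auto simp: le_nat_iff le_floor_iff)
    then have "card X \<le> card {..nat \<lfloor>2 powr t\<rfloor>}"
      by (intro card_mono) auto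
    then have "real (card X) \<le> real (nat \<lfloor>2 powr t\<rfloor>) + 1"
      unfolding card_atMost by linarith
    also have "\<dots> \<le> 2 powr t + 1" by simp
    finally show "real (card X) \<le> 2 powr t + 1" .
  qed (use t in auto)
  finally have "real n powr (1 / t) * (2 * t) ^ card X \<le> x powr (2 / t) * (2 * t) powr (2 powr t + 1)"
    using ** t by (intro mult_mono) auto
  with * show ?thesis
    unfolding divisor_bound_def t_def by linarith
qed

text \<open>In terms of L = ln x the divisor bound has exponent 2 L / ln L plus a lower-order term.
  The room L / ln L up to 3 L / ln L absorbs that term and also the cube of 1 + ln x, which makes up
  for the harmonic sums in the later error terms.\<close>

lemma divisor_bound_asymp:
  "eventually (\<lambda>x. divisor_bound x * (1 + ln x) ^ 3 \<le> exp (3 * ln x / ln (ln x))) at_top"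
proof -
  \<comment> \<open>The exponent 25/36 is a rational upper bound for ln 2 that is still below 1, and
    \<open>2 powr ln L\<close> equals \<open>L powr ln 2\<close>.\<close>
  have "eventually (\<lambda>L::real. 2 * L / ln L + (L powr (25 / 36) + 1) * ln (2 * ln L) + 3 * ln (1 + L) \<le> 3 * L / ln L) at_top"
    by real_asymp
  moreover have "eventually (\<lambda>L::real. L > 1 \<and> ln L > 1) at_top"
    by (intro eventually_conj; real_asymp)
  ultimately have ev: "eventually (\<lambda>L::real. 2 * L / ln L + (2 powr ln L + 1) * ln (2 * ln L) + 3 * ln (1 + L) \<le> 3 * L / ln L) at_top"
  proof eventually_elim
    case (elim L)
    have "2 powr ln L = L powr ln 2"
      using elim by (simp add: powr_def mult_ac)
    also have "\<dots> \<le> L powr (25 / 36)"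
      using elim ln2_le_25_over_36 by (intro powr_mono) auto
    finally have "(2 powr ln L + 1) * ln (2 * ln L) \<le> (L powr (25 / 36) + 1) * ln (2 * ln L)"
      using elim by (intro mult_right_mono) auto
    then show ?case using elim by linarith
  qed
  have "eventually (\<lambda>x::real. 2 * ln x / ln (ln x) + (2 powr ln (ln x) + 1) * ln (2 * ln (ln x)) + 3 * ln (1 + ln x) \<le> 3 * ln x / ln (ln x)) at_top"
    by (rule eventually_compose_filterlim[OF ev ln_at_top])
  moreover have "eventually (\<lambda>x::real. x > 1 \<and> ln x > 0 \<and> ln (ln x) > 0) at_top"
    by (intro eventually_conj; real_asymp)
  ultimately show ?thesis
  proof eventually_elim
    case (elim x)
    have "divisor_bound x * (1 + ln x) ^ 3 = exp (2 * ln x / ln (ln x) + (2 powr ln (ln x) + 1) * ln (2 * ln (ln x)) + 3 * ln (1 + ln x))"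
      using elim unfolding divisor_bound_def exp_add 
      by (auto simp add: powr_def exp_of_nat_mult[of 3, simplified] mult_ac)
    also have "\<dots> \<le> exp (3 * ln x / ln (ln x))"
      using elim by simp
    finally show ?case .
  qed
qed

section \<open>Sawtooth and cotangent sums\<close>

text \<open>The sum telescopes, as 2 sin(x/2) cos(a x) = sin((a + 1/2) x) - sin((a - 1/2)
  x).\<close>

lemma sum_cos_arith_prog:
  fixes x :: real
  shows "2 * sin (x / 2) * (\<Sum>a<n. cos (real a * x)) = sin ((real n - 1 / 2) * x) + sin (x / 2)"
proof (induction n)
  case 0
  have "sin ((0 - 1 / 2) * x) = - sin (x / 2)"
    by (simp flip: sin_minus)
  then show ?case by simp
next
  case (Suc n)
  have "sin ((real n + 1 / 2) * x) - sin ((real n - 1 / 2) * x) = 2 * sin (x / 2) * cos (real n * x)"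
    using sin_diff_sin[of "(real n + 1 / 2) * x" "(real n - 1 / 2) * x"]
    by (simp add: field_simps)
  with Suc show ?case
    by (simp add: distrib_left) (simp add: algebra_simps)
qed

lemma sin_pi_frac_eq_0_iff:
  fixes t :: int and p :: nat
  assumes "p > 0"
  shows "sin (pi * real_of_int t / real p) = 0 \<longleftrightarrow> int p dvd t"
proof
  assume "sin (pi * real_of_int t / real p) = 0"
  then obtain i :: int where "pi * real_of_int t / real p = of_int i * pi"
    using sin_zero_iff_int2 by blast
  then have "real_of_int t = real_of_int (i * int p)"
    using assms by (simp add: field_simps)
  then have "t = i * int p" by (simp only: of_int_eq_iff)
  then show "int p dvd t" by simp
next
  assume "int p dvd t"
  then obtain i where "t = int p * i" by auto
  then have "pi * real_of_int t / real p = pi * of_int i"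
    using assms by (simp add: field_simps)
  then show "sin (pi * real_of_int t / real p) = 0"
    by (simp only: sin_npi_int)
qed

text \<open>Orthogonality of the additive characters modulo p; the term -1 is the omitted residue
  0.\<close>

lemma sum_cos_residues:
  fixes t :: int and p :: nat
  assumes "p > 0"
  shows "(\<Sum>a=1..int p - 1. cos (2 * pi * real_of_int (t * a) / real p)) = real p * of_bool (int p dvd t) - 1"
proof -
  define x where "x = 2 * pi * real_of_int t / real p"
  have "(\<Sum>a<p. cos (real a * x)) = real p * of_bool (int p dvd t)"
  proof (cases "int p dvd t")
    case True
    then obtain i where i: "t = int p * i" by auto
    have "cos (real a * x) = 1" for a
    proof -
      have "real a * x = 2 * pi * of_int (int a * i)"
        using assms by (simp add: x_def i field_simps)
      then show ?thesis by (simp only: cos_int_2pin)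
    qed
    then show ?thesis using True by simp
  next
    case False
    have *: "x / 2 = pi * real_of_int t / real p" by (simp add: x_def)
    have "sin (x / 2) \<noteq> 0"
      unfolding * using False sin_pi_frac_eq_0_iff[OF assms] by simp
    moreover have "sin ((real p - 1 / 2) * x) = - sin (x / 2)"
    proof -
      have "(real p - 1 / 2) * x = - (x / 2) + 2 * pi * of_int t"
        using assms by (simp add: x_def field_simps)
      then have "sin ((real p - 1 / 2) * x) = sin (- (x / 2))"
        by (simp only: sin_add sin_int_2pin cos_int_2pin mult_1_right mult_zero_right add_0_right)
      then show ?thesis by simp
    qed
    ultimately have "(\<Sum>a<p. cos (real a * x)) = 0"
      using sum_cos_arith_prog[of x p] by simp
    then show ?thesis using False by simp
  qed
  moreover have "(\<Sum>a<p. cos (real a * x)) = 1 + (\<Sum>a\<in>{1..<p}. cos (real a * x))"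
  proof -
    have "{..<p} = insert 0 {1..<p}" using assms by auto
    then show ?thesis by simp
  qed
  moreover have "(\<Sum>a\<in>{1..<p}. cos (real a * x)) = (\<Sum>a=1..int p - 1. cos (2 * pi * real_of_int (t * a) / real p))"
    by (rule sum.reindex_bij_witness[where i = nat and j = int])
       (auto simp: x_def field_simps of_nat_diff)
  ultimately show ?thesis by simp
qed

text \<open>This is Eisenstein's finite Fourier formula, by telescoping in a. With y = pi k / p,
  multiplying sin(2(a+1)y) - sin(2ay) by cot y cancels the sine and leaves cos(2(a+1)y) + cos(2ay),
  whose sum over k is known.\<close>

lemma cot_sin_transform:
  fixes p a :: nat
  assumes "1 \<le> a" "a < p"
  shows "(\<Sum>k=1..int p - 1. cot (pi * real_of_int k / real p) * sin (2 * pi * real_of_int (k * int a) / real p))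
     = real p - 2 * real a"
proof -
  define f where "f a = (\<Sum>k=1..int p - 1. cot (pi * real_of_int k / real p) * sin (2 * pi * real_of_int (k * int a) / real p))" for a :: nat
  define c where "c a = (\<Sum>k=1..int p - 1. cos (2 * pi * real_of_int (int a * k) / real p))" for a :: nat
  have p0: "p > 0" using assms by simp
  have step: "f (Suc a) - f a = c (Suc a) + c a" for a
  proof -
    have "f (Suc a) - f a = (\<Sum>k=1..int p - 1. cos (2 * pi * real_of_int (int (Suc a) * k) / real p) + cos (2 * pi * real_of_int (int a * k) / real p))"
      unfolding f_def sum_subtractf[symmetric]
    proof (intro sum.cong refl)
      fix k assume k: "k \<in> {1..int p - 1}"
      define y where "y = pi * real_of_int k / real p"
      have "\<not> int p dvd k" using k zdvd_not_zless by fastforce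
      then have s: "sin y \<noteq> 0" unfolding y_def using sin_pi_frac_eq_0_iff[OF p0] by simp
      have e: "2 * pi * real_of_int (k * int b) / real p = 2 * real b * y" "2 * pi * real_of_int (int b * k) / real p = 2 * real b * y" for b
        by (simp_all add: y_def)
      have half: "(2 * real (Suc a) * y - 2 * real a * y) / 2 = y"
        "(2 * real (Suc a) * y + 2 * real a * y) / 2 = (2 * real a + 1) * y"
        by (simp_all add: algebra_simps add_divide_distrib)
      have "sin (2 * real (Suc a) * y) - sin (2 * real a * y) = 2 * sin y * cos ((2 * real a + 1) * y)"
        using sin_diff_sin[of "2 * real (Suc a) * y" "2 * real a * y"] unfolding half .
      then have "cot y * sin (2 * real (Suc a) * y) - cot y * sin (2 * real a * y) = 2 * cos y * cos ((2 * real a + 1) * y)"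
        using s unfolding right_diff_distrib[symmetric] by (simp add: cot_def)
      also have "\<dots> = cos (2 * real (Suc a) * y) + cos (2 * real a * y)"
        using cos_plus_cos[of "2 * real (Suc a) * y" "2 * real a * y"] unfolding half by simp
      finally show "cot (pi * real_of_int k / real p) * sin (2 * pi * real_of_int (k * int (Suc a)) / real p) -
         cot (pi * real_of_int k / real p) * sin (2 * pi * real_of_int (k * int a) / real p) =
         cos (2 * pi * real_of_int (int (Suc a) * k) / real p) + cos (2 * pi * real_of_int (int a * k) / real p)"
        unfolding e y_def[symmetric] .
    qed
    then show ?thesis by (simp add: c_def sum.distrib)
  qed
  \<comment> \<open>Only \<open>c 0\<close> differs from -1, so the first step contributes
    \<open>p - 2\<close> and each later one -2.\<close>
  have c: "c a = (if a = 0 then real p - 1 else - 1)" if "a < p" for a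
  proof -
    have "int p dvd int a \<longleftrightarrow> a = 0" using that by (auto dest: dvd_imp_le)
    then show ?thesis unfolding c_def sum_cos_residues[OF p0] by simp
  qed
  have "f a = real p - 2 * real a" using assms
  proof (induction a rule: dec_induct)
    case base
    have "f 0 = 0" by (simp add: f_def)
    then show ?case using step[of 0] c[of 0] c[of 1] assms base by simp
  next
    case (step m)
    then show ?case using \<open>\<And>a. f (Suc a) - f a = c (Suc a) + c a\<close>[of m] c[of m] c[of "Suc m"] by simp
  qed
  then show ?thesis by (simp add: f_def)
qed

section \<open>Periodic functions on the units modulo an odd prime\<close>

locale odd_prime =
  fixes p :: nat
  assumes prime: "prime p" and odd: "odd p"
begin

definition units :: "int set" where "units = {1..int p - 1}"

definition saw :: "int \<Rightarrow> real" where "saw x = real_of_int (x mod int p) / real p - 1 / 2"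

definition cotp :: "int \<Rightarrow> real" where "cotp k = cot (pi * real_of_int k / real p)"

definition periodic :: "(int \<Rightarrow> real) \<Rightarrow> bool" where
  "periodic f \<longleftrightarrow> (\<forall>x. f (x mod int p) = f x)"

lemma periodicD: "periodic f \<Longrightarrow> f (x mod int p) = f x"
  by (simp add: periodic_def)

lemma periodic_cong: "periodic f \<Longrightarrow> [x = y] (mod int p) \<Longrightarrow> f x = f y"
  by (metis periodicD unique_euclidean_semiring_class.cong_def)

lemma periodicI: "(\<And>x y. [x = y] (mod int p) \<Longrightarrow> f x = f y) \<Longrightarrow> periodic f"
  unfolding periodic_def by (metis cong_mod_left cong_refl)

lemma p_pos: "p > 0"
  using prime by (simp add: prime_gt_0_nat)

lemma finite_units: "finite units"
  by (simp add: units_def)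

lemma mod_in_units: "x mod int p \<in> units \<longleftrightarrow> \<not> int p dvd x"
  unfolding units_def using p_pos pos_mod_sign[of "int p" x] pos_mod_bound[of "int p" x]
  by (simp only: atLeastAtMost_iff dvd_eq_mod_eq_0) linarith

lemma units_not_dvd: "k \<in> units \<Longrightarrow> \<not> int p dvd k"
  unfolding units_def using zdvd_not_zless by fastforce

lemma units_mult_not_dvd: "k \<in> units \<Longrightarrow> h \<in> units \<Longrightarrow> \<not> int p dvd h * k"
  using units_not_dvd prime prime_dvd_mult_iff[of "int p"] by auto

lemma units_cong_imp_eq: "x \<in> units \<Longrightarrow> y \<in> units \<Longrightarrow> [x = y] (mod int p) \<Longrightarrow> x = y"
  by (auto simp: units_def unique_euclidean_semiring_class.cong_def)

lemma cong_mult_unit_iff: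
  assumes "k \<in> units"
  shows "[k * x = k * y] (mod int p) \<longleftrightarrow> [x = y] (mod int p)"
proof (rule cong_mult_lcancel)
  show "coprime k (int p)"
    using units_not_dvd[OF assms] prime prime_imp_coprime[of "int p" k] by (simp add: coprime_commute)
qed

text \<open>Multiplication by a unit permutes the nonzero residues.\<close>

lemma sum_units_mult:
  assumes "periodic g" "k \<in> units"
  shows "(\<Sum>n\<in>units. g n) = (\<Sum>h\<in>units. g (h * k))"
proof -
  have inj: "inj_on (\<lambda>h. (h * k) mod int p) units"
  proof (rule inj_onI)
    fix x y assume xy: "x \<in> units" "y \<in> units" "x * k mod int p = y * k mod int p"
    then have "[k * x = k * y] (mod int p)" by (simp add: unique_euclidean_semiring_class.cong_def mult.commute)
    then show "x = y" using cong_mult_unit_iff[OF assms(2)] units_cong_imp_eq xy by blast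
  qed
  have "(\<lambda>h. (h * k) mod int p) ` units \<subseteq> units"
    using units_mult_not_dvd assms mod_in_units by auto
  then have "(\<lambda>h. (h * k) mod int p) ` units = units"
    using endo_inj_surj[OF finite_units _ inj] by blast
  then have "(\<Sum>n\<in>units. g n) = (\<Sum>n\<in>(\<lambda>h. (h * k) mod int p) ` units. g n)" by simp
  also have "\<dots> = (\<Sum>h\<in>units. g (h * k))"
    by (simp add: sum.reindex[OF inj] periodicD[OF assms(1)])
  finally show ?thesis .
qed

lemma sum_units_of_bool:
  assumes "periodic f" "\<not> int p dvd x"
  shows "(\<Sum>l\<in>units. of_bool [l = x] (mod int p) * f l) = f x"
proof -
  have "(\<Sum>l\<in>units. of_bool [l = x] (mod int p) * f l) = (\<Sum>l\<in>units. if l = x mod int p then f l else 0)"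
  proof (intro sum.cong refl)
    fix l assume l: "l \<in> units"
    have "[l = x] (mod int p) \<longleftrightarrow> l = x mod int p"
      using l by (auto simp: units_def unique_euclidean_semiring_class.cong_def)
    then show "of_bool [l = x] (mod int p) * f l = (if l = x mod int p then f l else 0)" by simp
  qed
  also have "\<dots> = f x"
    using assms mod_in_units finite_units by (simp add: periodicD)
  finally show ?thesis .
qed

text \<open>The congruence enters as an \<open>of_bool\<close> weight, so that all four sums keep a
  fixed range and can be interchanged freely.\<close>

definition quad :: "(int \<Rightarrow> real) \<Rightarrow> real" where
  "quad f = (\<Sum>k\<in>units. \<Sum>l\<in>units. \<Sum>m\<in>units. \<Sum>n\<in>units.
      of_bool [k * l = m * n] (mod int p) * (f k * f l * f m * f n))"

text \<open>Expanding the square gives two factorisations of the same d; since \<open>m * n\<close>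
  is a unit, exactly one d in \<open>units\<close> survives, and the two conditions merge into one
  congruence.\<close>

lemma quad_eq_sum_products:
  "(\<Sum>d\<in>units. (\<Sum>a\<in>units. \<Sum>b\<in>units. of_bool [a * b = d] (mod int p) * (f a * f b))\<^sup>2) = quad f"
proof -
  have "(\<Sum>d\<in>units. (\<Sum>a\<in>units. \<Sum>b\<in>units. of_bool [a * b = d] (mod int p) * (f a * f b))\<^sup>2)
      = (\<Sum>d\<in>units. \<Sum>k\<in>units. \<Sum>l\<in>units. \<Sum>m\<in>units. \<Sum>n\<in>units.
          of_bool [k * l = d] (mod int p) * of_bool [m * n = d] (mod int p) * (f k * f l * f m * f n))"
  proof (intro sum.cong refl)
    fix d
    define F where "F a b = of_bool [a * b = d] (mod int p) * (f a * f b)" for a b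
    have "(\<Sum>a\<in>units. \<Sum>b\<in>units. F a b)\<^sup>2 = (\<Sum>k\<in>units. \<Sum>l\<in>units. F k l * (\<Sum>m\<in>units. \<Sum>n\<in>units. F m n))"
      by (simp only: power2_eq_square sum_distrib_right)
    also have "\<dots> = (\<Sum>k\<in>units. \<Sum>l\<in>units. \<Sum>m\<in>units. \<Sum>n\<in>units. F k l * F m n)"
      by (simp only: sum_distrib_left)
    finally show "(\<Sum>a\<in>units. \<Sum>b\<in>units. of_bool [a * b = d] (mod int p) * (f a * f b))\<^sup>2
      = (\<Sum>k\<in>units. \<Sum>l\<in>units. \<Sum>m\<in>units. \<Sum>n\<in>units.
          of_bool [k * l = d] (mod int p) * of_bool [m * n = d] (mod int p) * (f k * f l * f m * f n))"
      unfolding F_def by (simp only: mult_ac)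
  qed
  also have "\<dots> = (\<Sum>k\<in>units. \<Sum>l\<in>units. \<Sum>m\<in>units. \<Sum>n\<in>units. \<Sum>d\<in>units. 
          of_bool [k * l = d] (mod int p) * of_bool [m * n = d] (mod int p) * (f k * f l * f m * f n))"
    by (rule trans[OF sum.swap], rule sum.cong[OF refl], rule trans[OF sum.swap], rule sum.cong[OF refl],
        rule trans[OF sum.swap], rule sum.cong[OF refl], rule sum.swap)
  also have "\<dots> = quad f"
    unfolding quad_def
  proof (intro sum.cong refl)
    fix k l m n assume "k \<in> units" "l \<in> units" "m \<in> units" "n \<in> units"
    then have "\<not> int p dvd m * n" using units_mult_not_dvd by blast
    have "(\<Sum>d\<in>units. of_bool [k * l = d] (mod int p) * of_bool [m * n = d] (mod int p) * (f k * f l * f m * f n))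
      = (\<Sum>d\<in>units. of_bool [d = m * n] (mod int p) * (of_bool [k * l = d] (mod int p) * (f k * f l * f m * f n)))"
      by (intro sum.cong refl) (simp add: cong_sym_eq)
    also have "\<dots> = of_bool [k * l = m * n] (mod int p) * (f k * f l * f m * f n)"
      by (rule sum_units_of_bool[where f = "\<lambda>d. of_bool [k * l = d] (mod int p) * (f k * f l * f m * f n)"])
         (use \<open>\<not> int p dvd m * n\<close> in \<open>auto simp: periodic_def unique_euclidean_semiring_class.cong_def\<close>)
    finally show "(\<Sum>d\<in>units. of_bool [k * l = d] (mod int p) * of_bool [m * n = d] (mod int p) * (f k * f l * f m * f n))
      = of_bool [k * l = m * n] (mod int p) * (f k * f l * f m * f n)" .
  qed
  finally show ?thesis .
qed

text \<open>For fixed \<open>k\<close> and \<open>m\<close> the solutions of \<open>k l \<equiv> m n\<close> are \<open>(l, n) \<equiv> (h m, h k)\<close>.\<close>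

lemma quad_eq_sum_ratios:
  assumes f: "periodic f"
  shows "quad f = (\<Sum>h\<in>units. (\<Sum>a\<in>units. f a * f (h * a))\<^sup>2)"
proof -
  have inner: "(\<Sum>l\<in>units. \<Sum>n\<in>units. of_bool [k * l = m * n] (mod int p) * (f l * f n))
        = (\<Sum>h\<in>units. f (h * k) * f (h * m))"
    if k: "k \<in> units" and m: "m \<in> units" for k m
  proof -
    define g where "g n = (\<Sum>l\<in>units. of_bool [k * l = m * n] (mod int p) * (f l * f n))" for n
    have "periodic g"
    proof (rule periodicI)
      fix x y assume xy: "[x = y] (mod int p)"
      have "[k * l = m * x] (mod int p) \<longleftrightarrow> [k * l = m * y] (mod int p)" for l
        using cong_scalar_left[OF xy, of m] cong_trans cong_sym by blast
      then show "g x = g y" unfolding g_def periodic_cong[OF f xy] by simp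
    qed
    have "(\<Sum>l\<in>units. \<Sum>n\<in>units. of_bool [k * l = m * n] (mod int p) * (f l * f n)) = (\<Sum>n\<in>units. g n)"
      unfolding g_def by (rule sum.swap)
    also have "\<dots> = (\<Sum>h\<in>units. g (h * k))" by (rule sum_units_mult) fact+
    also have "\<dots> = (\<Sum>h\<in>units. f (h * k) * f (h * m))"
    proof (intro sum.cong refl)
      fix h assume h: "h \<in> units"
      have "g (h * k) = f (h * k) * (\<Sum>l\<in>units. of_bool [l = h * m] (mod int p) * f l)"
        unfolding g_def sum_distrib_left
      proof (intro sum.cong refl)
        fix l
        have "m * (h * k) = k * (h * m)" by simp
        then have "[k * l = m * (h * k)] (mod int p) \<longleftrightarrow> [l = h * m] (mod int p)"
          using cong_mult_unit_iff[OF k] by metis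
        then show "of_bool [k * l = m * (h * k)] (mod int p) * (f l * f (h * k))
          = f (h * k) * (of_bool [l = h * m] (mod int p) * f l)" by simp
      qed
      also have "(\<Sum>l\<in>units. of_bool [l = h * m] (mod int p) * f l) = f (h * m)"
        using units_mult_not_dvd[OF m h] by (rule sum_units_of_bool[OF f])
      finally show "g (h * k) = f (h * k) * f (h * m)" .
    qed
    finally show ?thesis .
  qed
  have "quad f = (\<Sum>k\<in>units. \<Sum>m\<in>units. \<Sum>l\<in>units. \<Sum>n\<in>units. of_bool [k * l = m * n] (mod int p) * (f k * f l * f m * f n))"
    unfolding quad_def by (intro sum.cong refl sum.swap)
  also have "\<dots> = (\<Sum>k\<in>units. \<Sum>m\<in>units. f k * f m * (\<Sum>l\<in>units. \<Sum>n\<in>units. of_bool [k * l = m * n] (mod int p) * (f l * f n)))"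
    unfolding sum_distrib_left by (intro sum.cong refl) simp
  also have "\<dots> = (\<Sum>k\<in>units. \<Sum>m\<in>units. f k * f m * (\<Sum>h\<in>units. f (h * k) * f (h * m)))"
    by (intro sum.cong refl arg_cong2[of _ _ _ _ "(*)"] inner)
  also have "\<dots> = (\<Sum>k\<in>units. \<Sum>m\<in>units. \<Sum>h\<in>units. (f k * f (h * k)) * (f m * f (h * m)))"
    unfolding sum_distrib_left by (intro sum.cong refl) simp
  also have "\<dots> = (\<Sum>k\<in>units. \<Sum>h\<in>units. \<Sum>m\<in>units. (f k * f (h * k)) * (f m * f (h * m)))"
    by (intro sum.cong refl sum.swap)
  also have "\<dots> = (\<Sum>h\<in>units. \<Sum>k\<in>units. \<Sum>m\<in>units. (f k * f (h * k)) * (f m * f (h * m)))"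
    by (rule sum.swap)
  also have "\<dots> = (\<Sum>h\<in>units. (\<Sum>a\<in>units. f a * f (h * a))\<^sup>2)"
    by (simp add: power2_eq_square sum_product)
  finally show ?thesis .
qed

section \<open>From the sawtooth to the cotangent by finite Fourier expansion\<close>

lemma periodic_saw: "periodic saw"
  by (simp add: periodic_def saw_def)

lemma periodic_cotp: "periodic cotp"
proof (rule periodicI)
  fix x y assume "[x = y] (mod int p)"
  then obtain i where i: "x = y + int p * i"
    by (metis cong_iff_lin cong_sym)
  have e: "pi * real_of_int x / real p = pi * real_of_int y / real p + of_int i * pi"
    using p_pos by (simp add: i field_simps)
  have s: "sin (of_int i * pi) = 0" using sin_zero_iff_int2 by blast
  then have c: "(cos (of_int i * pi))\<^sup>2 = 1" using sin_cos_squared_add[of "of_int i * pi"] by simp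
  then have c0: "cos (of_int i * pi) \<noteq> 0" by auto
  show "cotp x = cotp y"
    unfolding cotp_def e cot_def sin_add cos_add s using c0 by simp
qed

lemma cotp_minus: "cotp (- x) = - cotp x"
  by (simp add: cotp_def cot_def)

text \<open>Here \<open>cot_sin_transform\<close> is applied at the residue a of x, as
  \<open>p - 2 * a\<close> is \<open>- 2 * p\<close> times the sawtooth value. Multiples of p are
  excluded because there the sine sum vanishes while \<open>saw\<close> is -1/2.\<close>

lemma saw_fourier:
  assumes "\<not> int p dvd x"
  shows "saw x = - 1 / (2 * real p) * (\<Sum>k\<in>units. cotp k * sin (2 * pi * real_of_int (k * x) / real p))"
proof -
  define a where "a = nat (x mod int p)"
  have u: "x mod int p \<in> units" using assms mod_in_units by simp
  then have a: "1 \<le> a" "a < p" "int a = x mod int p"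
    unfolding a_def units_def by auto
  obtain i where i: "x = int a + int p * i"
    using a by (metis mod_mult_div_eq)
  have "(\<Sum>k\<in>units. cotp k * sin (2 * pi * real_of_int (k * x) / real p)) = (\<Sum>k\<in>units. cotp k * sin (2 * pi * real_of_int (k * int a) / real p))"
  proof (intro sum.cong refl)
    fix k
    have "2 * pi * real_of_int (k * x) / real p = 2 * pi * real_of_int (k * int a) / real p + 2 * pi * of_int (k * i)"
      using p_pos by (simp add: i field_simps)
    then show "cotp k * sin (2 * pi * real_of_int (k * x) / real p) = cotp k * sin (2 * pi * real_of_int (k * int a) / real p)"
      by (simp only: sin_add sin_int_2pin cos_int_2pin mult_1_right mult_zero_right add_0_right)
  qed
  also have "\<dots> = real p - 2 * real a"
    using cot_sin_transform[OF a(1,2)] unfolding units_def cotp_def .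
  finally have "(\<Sum>k\<in>units. cotp k * sin (2 * pi * real_of_int (k * x) / real p)) = real p - 2 * real a" .
  then show ?thesis
    unfolding saw_def a(3)[symmetric] using p_pos by (simp only: of_int_of_nat_eq) (simp add: field_simps)
qed

text \<open>The product of sines is half a difference of cosines, and the terms -1 of the two cosine
  sums cancel.\<close>

lemma sum_sin_sin_units:
  "(\<Sum>a\<in>units. sin (2 * pi * real_of_int (k * a) / real p) * sin (2 * pi * real_of_int (l * a) / real p))
    = real p / 2 * (of_bool [k = l] (mod int p) - of_bool [k = - l] (mod int p))"
proof -
  have "(\<Sum>a\<in>units. sin (2 * pi * real_of_int (k * a) / real p) * sin (2 * pi * real_of_int (l * a) / real p))
     = (\<Sum>a\<in>units. (cos (2 * pi * real_of_int ((k - l) * a) / real p) - cos (2 * pi * real_of_int ((k + l) * a) / real p)) / 2)"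
    unfolding sin_times_sin
    by (intro sum.cong refl) (simp add: algebra_simps add_divide_distrib diff_divide_distrib)
  also have "\<dots> = ((real p * of_bool (int p dvd k - l) - 1) - (real p * of_bool (int p dvd k + l) - 1)) / 2"
    unfolding sum_divide_distrib[symmetric] sum_subtractf units_def
    by (simp only: sum_cos_residues[OF p_pos])
  also have "int p dvd k - l \<longleftrightarrow> [k = l] (mod int p)"
    by (simp add: cong_iff_dvd_diff)
  also have "int p dvd k + l \<longleftrightarrow> [k = - l] (mod int p)"
    by (simp add: cong_iff_dvd_diff)
  finally show ?thesis by (simp add: field_simps)
qed

text \<open>The Dedekind sum on the left is turned into a cotangent sum by expanding both sawtooth
  factors. Summing over a first leaves only k congruent to h l or to - h l.\<close>

lemma sum_saw_saw:
  assumes h: "h \<in> units"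
  shows "(\<Sum>a\<in>units. saw a * saw (h * a)) = 1 / (4 * real p) * (\<Sum>k\<in>units. cotp k * cotp (h * k))"
proof -
  let ?s = "\<lambda>t a. sin (2 * pi * real_of_int (t * a) / real p)"
  have "(\<Sum>a\<in>units. saw a * saw (h * a)) = (\<Sum>a\<in>units. (- 1 / (2 * real p) * (\<Sum>k\<in>units. cotp k * ?s k a)) * (- 1 / (2 * real p) * (\<Sum>l\<in>units. cotp l * ?s (h * l) a)))"
  proof (intro sum.cong refl)
    fix a assume a: "a \<in> units"
    have "saw (h * a) = - 1 / (2 * real p) * (\<Sum>l\<in>units. cotp l * ?s l (h * a))"
      using units_mult_not_dvd[OF a h] by (rule saw_fourier)
    moreover have "l * (h * a) = (h * l) * a" for l by simp
    ultimately show "saw a * saw (h * a) = (- 1 / (2 * real p) * (\<Sum>k\<in>units. cotp k * ?s k a)) * (- 1 / (2 * real p) * (\<Sum>l\<in>units. cotp l * ?s (h * l) a))"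
      using saw_fourier[OF units_not_dvd[OF a]] by simp
  qed
  also have "\<dots> = (\<Sum>a\<in>units. 1 / (4 * (real p)\<^sup>2) * (\<Sum>l\<in>units. \<Sum>k\<in>units. cotp l * cotp k * (?s k a * ?s (h * l) a)))"
  proof (intro sum.cong refl)
    fix a
    have "(\<Sum>k\<in>units. cotp k * ?s k a) * (\<Sum>l\<in>units. cotp l * ?s (h * l) a) = (\<Sum>l\<in>units. \<Sum>k\<in>units. cotp l * cotp k * (?s k a * ?s (h * l) a))"
      unfolding sum_product by (subst sum.swap) (simp add: mult_ac)
    then show "(- 1 / (2 * real p) * (\<Sum>k\<in>units. cotp k * ?s k a)) * (- 1 / (2 * real p) * (\<Sum>l\<in>units. cotp l * ?s (h * l) a))
      = 1 / (4 * (real p)\<^sup>2) * (\<Sum>l\<in>units. \<Sum>k\<in>units. cotp l * cotp k * (?s k a * ?s (h * l) a))"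
      by (simp add: power2_eq_square)
  qed
  also have "\<dots> = 1 / (4 * (real p)\<^sup>2) * (\<Sum>a\<in>units. \<Sum>l\<in>units. \<Sum>k\<in>units. cotp l * cotp k * (?s k a * ?s (h * l) a))"
    by (simp only: sum_distrib_left)
  also have "(\<Sum>a\<in>units. \<Sum>l\<in>units. \<Sum>k\<in>units. cotp l * cotp k * (?s k a * ?s (h * l) a))
      = (\<Sum>l\<in>units. \<Sum>a\<in>units. \<Sum>k\<in>units. cotp l * cotp k * (?s k a * ?s (h * l) a))"
    by (rule sum.swap)
  also have "\<dots> = (\<Sum>l\<in>units. \<Sum>k\<in>units. \<Sum>a\<in>units. cotp l * cotp k * (?s k a * ?s (h * l) a))"
    by (intro sum.cong refl sum.swap)
  also have "\<dots> = (\<Sum>l\<in>units. \<Sum>k\<in>units. cotp l * cotp k * (real p / 2 * (of_bool [k = h * l] (mod int p) - of_bool [k = - (h * l)] (mod int p))))"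
    by (simp only: sum_distrib_left[symmetric] sum_sin_sin_units)
  \<comment> \<open>The cotangent is odd, so the term with k congruent to - h l, which carries a
    minus sign, equals the other one; together they turn \<open>p / 2\<close> into
    \<open>p\<close>.\<close>
  also have "\<dots> = (\<Sum>l\<in>units. real p * (cotp l * cotp (h * l)))"
  proof (intro sum.cong refl)
    fix l assume l: "l \<in> units"
    have nd: "\<not> int p dvd h * l" "\<not> int p dvd - (h * l)" using units_mult_not_dvd[OF l h] by auto
    have "(\<Sum>k\<in>units. cotp l * cotp k * (real p / 2 * (of_bool [k = h * l] (mod int p) - of_bool [k = - (h * l)] (mod int p))))
      = real p / 2 * cotp l * ((\<Sum>k\<in>units. of_bool [k = h * l] (mod int p) * cotp k) - (\<Sum>k\<in>units. of_bool [k = - (h * l)] (mod int p) * cotp k))"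
      unfolding sum_subtractf[symmetric] sum_distrib_left by (intro sum.cong refl) (simp add: algebra_simps)
    also have "\<dots> = real p * (cotp l * cotp (h * l))"
      by (simp only: sum_units_of_bool[OF periodic_cotp] nd cotp_minus simp_thms) simp
    finally show "(\<Sum>k\<in>units. cotp l * cotp k * (real p / 2 * (of_bool [k = h * l] (mod int p) - of_bool [k = - (h * l)] (mod int p))))
       = real p * (cotp l * cotp (h * l))" .
  qed
  also have "1 / (4 * (real p)\<^sup>2) * (\<Sum>l\<in>units. real p * (cotp l * cotp (h * l))) = 1 / (4 * real p) * (\<Sum>k\<in>units. cotp k * cotp (h * k))"
    unfolding sum_distrib_left[symmetric] using p_pos by (simp add: power2_eq_square)
  finally show ?thesis .
qed

text \<open>Both sides are second moments over the ratio h, so the factor \<open>1 / (4 * p)\<close>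
  of \<open>sum_saw_saw\<close> gets squared. The gain is that the cotangent is concentrated on
  residues close to 0, where the congruence can be compared with an equation in integers.\<close>

lemma quad_saw_eq: "quad saw = quad cotp / (16 * (real p)\<^sup>2)"
proof -
  have "quad saw = (\<Sum>h\<in>units. (1 / (4 * real p) * (\<Sum>k\<in>units. cotp k * cotp (h * k)))\<^sup>2)"
    unfolding quad_eq_sum_ratios[OF periodic_saw] by (intro sum.cong refl) (simp only: sum_saw_saw)
  also have "\<dots> = (\<Sum>h\<in>units. (\<Sum>k\<in>units. cotp k * cotp (h * k))\<^sup>2 / (16 * (real p)\<^sup>2))"
    by (intro sum.cong refl) (simp add: power_mult_distrib power_divide)
  also have "\<dots> = quad cotp / (16 * (real p)\<^sup>2)"
    unfolding quad_eq_sum_ratios[OF periodic_cotp] sum_divide_distrib ..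
  finally show ?thesis .
qed

text \<open>Multiplying out \<open>p^2 * saw a * saw b\<close> gives \<open>a * b\<close> minus p/2
  times \<open>a + b\<close> plus p^2/4. Every a has exactly one partner b, so a and b each sum to p
  (p - 1) / 2 and the count is p - 1; the corrections combine to - p^2 (p - 1) / 4.\<close>

lemma S_eq_saw:
  assumes d: "d \<in> {1..p - 1}"
  shows "real (S p d) - (real p)\<^sup>2 * (real p - 1) / 4
     = (real p)\<^sup>2 * (\<Sum>a\<in>units. \<Sum>b\<in>units. of_bool [a * b = int d] (mod int p) * (saw a * saw b))"
proof -
  let ?c = "\<lambda>a b. of_bool [a * b = int d] (mod int p) :: real"
  have du: "int d \<in> units" using d by (auto simp: units_def)
  have count: "(\<Sum>b\<in>units. ?c a b) = 1" if a: "a \<in> units" for a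
  proof -
    have "(\<Sum>b\<in>units. ?c a b) = (\<Sum>b\<in>units. of_bool [b * a = int d] (mod int p))"
      by (simp add: mult.commute)
    also have "\<dots> = (\<Sum>n\<in>units. of_bool [n = int d] (mod int p))"
      by (rule sum_units_mult[symmetric]) (auto simp: periodic_def unique_euclidean_semiring_class.cong_def a)
    also have "\<dots> = 1"
      using sum_units_of_bool[of "\<lambda>_. 1" "int d"] units_not_dvd[OF du] by (simp add: periodic_def)
    finally show ?thesis .
  qed
  have total: "(\<Sum>a\<in>units. real_of_int a) = real p * (real p - 1) / 2"
  proof -
    have "(\<Sum>a\<in>units. real_of_int a) = (\<Sum>a=1..p - 1. real a)"
      by (rule sum.reindex_bij_witness[where i = int and j = nat]) (auto simp: units_def)
    also have "\<dots> = real (p - 1) * (real (p - 1) + 1) / 2"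
      using double_gauss_sum_from_Suc_0[of "p - 1", where 'a = real] by simp
    finally show ?thesis using p_pos by (simp add: of_nat_diff mult.commute)
  qed
  have one: "(\<Sum>a\<in>units. 1) = real p - 1"
    using p_pos by (simp add: units_def)
  have first: "(\<Sum>a\<in>units. \<Sum>b\<in>units. ?c a b * real_of_int a) = real p * (real p - 1) / 2"
    unfolding total[symmetric] by (intro sum.cong refl) (simp add: count flip: sum_distrib_right)
  have second: "(\<Sum>a\<in>units. \<Sum>b\<in>units. ?c a b * real_of_int b) = real p * (real p - 1) / 2"
    unfolding first[symmetric] by (subst sum.swap) (simp add: mult.commute)
  have third: "(\<Sum>a\<in>units. \<Sum>b\<in>units. ?c a b) = real p - 1"
    unfolding one[symmetric] by (intro sum.cong refl count)
  have S: "real (S p d) = (\<Sum>a\<in>units. \<Sum>b\<in>units. ?c a b * (real_of_int a * real_of_int b))"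
  proof -
    have "real (S p d) = (\<Sum>(a, b) | a \<in> {1..p - 1} \<and> b \<in> {1..p - 1} \<and> [a * b = d] (mod p). real a * real b)"
      unfolding S_def by (simp add: case_prod_beta)
    also have "\<dots> = (\<Sum>(a, b)\<in>{1..p - 1} \<times> {1..p - 1}. of_bool [a * b = d] (mod p) * (real a * real b))"
      by (intro sum.mono_neutral_cong_left) auto
    also have "\<dots> = (\<Sum>(a, b)\<in>units \<times> units. ?c a b * (real_of_int a * real_of_int b))"
      by (rule sum.reindex_bij_witness[where i = "map_prod nat nat" and j = "map_prod int int"])
         (auto simp: units_def simp flip: cong_int_iff)
    finally show ?thesis by (simp add: sum.cartesian_product)
  qed
  have "(real p)\<^sup>2 * (\<Sum>a\<in>units. \<Sum>b\<in>units. ?c a b * (saw a * saw b))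
    = (\<Sum>a\<in>units. \<Sum>b\<in>units. ?c a b * (real_of_int a * real_of_int b) - real p / 2 * (?c a b * real_of_int a)
        - real p / 2 * (?c a b * real_of_int b) + (real p)\<^sup>2 / 4 * ?c a b)"
    unfolding sum_distrib_left
  proof (intro sum.cong refl)
    fix a b assume ab: "a \<in> units" "b \<in> units"
    have saw: "saw a = real_of_int a / real p - 1 / 2" "saw b = real_of_int b / real p - 1 / 2"
      using ab by (auto simp: saw_def units_def)
    have "(real p)\<^sup>2 * (saw a * saw b) = real_of_int a * real_of_int b - real p / 2 * real_of_int a - real p / 2 * real_of_int b + (real p)\<^sup>2 / 4"
      unfolding saw using p_pos by (simp add: field_simps power2_eq_square)
    then show "(real p)\<^sup>2 * (?c a b * (saw a * saw b)) = ?c a b * (real_of_int a * real_of_int b) - real p / 2 * (?c a b * real_of_int a)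
        - real p / 2 * (?c a b * real_of_int b) + (real p)\<^sup>2 / 4 * ?c a b"
      by (cases "[a * b = int d] (mod int p)") simp_all
  qed
  also have "\<dots> = real (S p d) - real p / 2 * (real p * (real p - 1) / 2) - real p / 2 * (real p * (real p - 1) / 2) + (real p)\<^sup>2 / 4 * (real p - 1)"
    unfolding sum.distrib sum_subtractf sum_distrib_left[symmetric] first second third S ..
  also have "\<dots> = real (S p d) - (real p)\<^sup>2 * (real p - 1) / 4"
    by (simp add: field_simps power2_eq_square)
  finally show ?thesis by simp
qed

lemma sum_S_eq_quad_cotp:
  "(\<Sum>d = 1..p - 1. \<bar>real (S p d) - (real p)\<^sup>2 * (real p - 1) / 4\<bar>\<^sup>2) = (real p)\<^sup>2 / 16 * quad cotp"
proof -
  have "(\<Sum>d = 1..p - 1. \<bar>real (S p d) - (real p)\<^sup>2 * (real p - 1) / 4\<bar>\<^sup>2)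
     = (\<Sum>d = 1..p - 1. (real p) ^ 4 * (\<Sum>a\<in>units. \<Sum>b\<in>units. of_bool [a * b = int d] (mod int p) * (saw a * saw b))\<^sup>2)"
    by (intro sum.cong refl) (simp only: power2_abs S_eq_saw power_mult_distrib flip: power_mult, simp)
  also have "\<dots> = (\<Sum>d\<in>units. (real p) ^ 4 * (\<Sum>a\<in>units. \<Sum>b\<in>units. of_bool [a * b = d] (mod int p) * (saw a * saw b))\<^sup>2)"
    by (rule sum.reindex_bij_witness[where i = nat and j = int]) (auto simp: units_def)
  also have "\<dots> = (real p) ^ 4 * quad saw"
    by (simp only: sum_distrib_left[symmetric] quad_eq_sum_products)
  also have "\<dots> = (real p)\<^sup>2 / 16 * quad cotp"
    unfolding quad_saw_eq using p_pos by (simp add: field_simps power2_eq_square eval_nat_numeral)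
  finally show ?thesis .
qed

end

section \<open>Estimates for the cotangent sum\<close>

text \<open>The upper bound is x cos x <= sin x, whose difference has derivative x sin x. The lower
  bound combines sin x <= x with cos x >= 1 - x^2/2 >= 1 - x, valid as x < 2.\<close>

lemma cot_bounds:
  fixes x :: real
  assumes x: "0 < x" "x < pi / 2"
  shows "0 \<le> cot x" "cot x \<le> 1 / x" "1 / x - 1 \<le> cot x"
proof -
  have s: "sin x > 0" "cos x > 0"
    using x by (auto intro: sin_gt_zero cos_gt_zero)
  show "0 \<le> cot x" using s by (simp add: cot_def)
  have "(\<lambda>x. sin x - x * cos x) 0 \<le> (\<lambda>x. sin x - x * cos x) x"
  proof (rule DERIV_nonneg_imp_nondecreasing[where f = "\<lambda>x. sin x - x * cos x"])
    fix y assume y: "0 \<le> y" "y \<le> x"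
    have "((\<lambda>x. sin x - x * cos x) has_real_derivative y * sin y) (at y)"
      by (auto intro!: derivative_eq_intros)
    moreover have "sin y \<ge> 0" using y x by (intro sin_ge_zero) auto
    ultimately show "\<exists>z. ((\<lambda>x. sin x - x * cos x) has_real_derivative z) (at y) \<and> 0 \<le> z"
      using y by (intro exI[of _ "y * sin y"]) auto
  qed (use x in auto)
  then have "x * cos x \<le> sin x" by simp
  then show "cot x \<le> 1 / x"
    using s x by (simp add: cot_def field_simps)
  have "cos x = 1 - 2 * (sin (x / 2))\<^sup>2"
    using cos_double_sin[of "x / 2"] by simp
  moreover have "(sin (x / 2))\<^sup>2 \<le> (x / 2)\<^sup>2"
    using x sin_x_le_x[of "x / 2"] sin_ge_zero[of "x / 2"] by (intro power_mono) auto
  ultimately have "cos x \<ge> 1 - x\<^sup>2 / 2" by (simp add: power_divide)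
  moreover have "x\<^sup>2 / 2 \<le> x"
    using x pi_less_4 by (simp add: power2_eq_square)
  ultimately have "1 - x \<le> cos x" by simp
  then have "(1 - x) / x \<le> cos x / x"
    using x by (intro divide_right_mono) auto
  also have "\<dots> \<le> cos x / sin x"
    using s x sin_x_le_x[of x] by (intro divide_left_mono) auto
  finally show "1 / x - 1 \<le> cot x"
    using x by (simp add: cot_def diff_divide_distrib)
qed

text \<open>The first factor determines the second because v is nonzero; the 2 counts the sign of
  the first factor.\<close>

lemma card_int_factorizations_le:
  fixes v :: int
  assumes "v \<noteq> 0"
  shows "card {(m, n). m \<in> A \<and> n \<in> A \<and> m * n = v} \<le> 2 * card {d. d dvd nat \<bar>v\<bar>}"
proof -
  define X where "X = {d. d dvd nat \<bar>v\<bar>}"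
  have finX: "finite X" unfolding X_def using assms by (intro finite_divisors_nat) auto
  have sub: "fst ` {(m, n). m \<in> A \<and> n \<in> A \<and> m * n = v} \<subseteq> int ` X \<union> (\<lambda>d. - int d) ` X"
  proof
    fix m assume "m \<in> fst ` {(m, n). m \<in> A \<and> n \<in> A \<and> m * n = v}"
    then have "m dvd v" by auto
    then have "nat \<bar>m\<bar> \<in> X" unfolding X_def by (simp add: nat_abs_dvd_iff)
    moreover have "m = int (nat \<bar>m\<bar>) \<or> m = - int (nat \<bar>m\<bar>)" by auto
    ultimately show "m \<in> int ` X \<union> (\<lambda>d. - int d) ` X" by blast
  qed
  have "card {(m, n). m \<in> A \<and> n \<in> A \<and> m * n = v} = card (fst ` {(m, n). m \<in> A \<and> n \<in> A \<and> m * n = v})"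
    using assms by (intro card_image[symmetric]) (auto simp: inj_on_def)
  also have "\<dots> \<le> card (int ` X \<union> (\<lambda>d. - int d) ` X)"
    using finX by (intro card_mono sub) auto
  also have "\<dots> \<le> card (int ` X) + card ((\<lambda>d. - int d) ` X)" by (rule card_Un_le)
  also have "\<dots> \<le> card X + card X"
    by (intro add_mono card_image_le finX)
  finally show ?thesis by (simp add: X_def)
qed

lemma card_nat_factorizations_le:
  fixes v :: nat
  assumes "v > 0"
  shows "card {(m, n). m \<in> A \<and> n \<in> A \<and> m * n = v} \<le> card {d. d dvd v}"
proof -
  have "card {(m, n). m \<in> A \<and> n \<in> A \<and> m * n = v} = card (fst ` {(m, n). m \<in> A \<and> n \<in> A \<and> m * n = v})"
    using assms by (intro card_image[symmetric]) (auto simp: inj_on_def)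
  also have "\<dots> \<le> card {d. d dvd v}"
    using assms by (intro card_mono) auto
  finally show ?thesis .
qed

text \<open>The factors are exchanged one at a time; each exchange costs at most 1 times the
  remaining three factors, which are bounded by their \<open>y\<close> values.\<close>

lemma prod4_diff_le:
  fixes x y :: "nat \<Rightarrow> real"
  assumes "\<And>i. 0 \<le> x i" "\<And>i. x i \<le> y i" "\<And>i. y i - x i \<le> 1"
  shows "\<bar>x a * x b * x c * x d - y a * y b * y c * y d\<bar>
    \<le> y b * y c * y d + y a * y c * y d + y a * y b * y d + y a * y b * y c"
proof -
  have y0: "0 \<le> y i" for i using assms(1,2) order_trans by blast
  have "x a * x b * x c * x d \<le> y a * y b * y c * y d"
    using assms y0 by (intro mult_mono mult_nonneg_nonneg) auto
  moreover have "(y a - x a) * (y b * y c * y d) \<le> 1 * (y b * y c * y d)"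
    using assms y0 by (intro mult_right_mono mult_nonneg_nonneg) auto
  moreover have "(y b - x b) * (x a * y c * y d) \<le> 1 * (y a * y c * y d)"
    using assms y0 by (intro mult_mono mult_nonneg_nonneg) (auto simp: mult_mono)
  moreover have "(y c - x c) * (x a * x b * y d) \<le> 1 * (y a * y b * y d)"
    using assms y0 by (intro mult_mono mult_nonneg_nonneg) (auto simp: mult_mono)
  moreover have "(y d - x d) * (x a * x b * x c) \<le> 1 * (y a * y b * y c)"
    using assms y0 by (intro mult_mono mult_nonneg_nonneg) (auto simp: mult_mono)
  moreover have "y a * y b * y c * y d - x a * x b * x c * x d
     = (y a - x a) * (y b * y c * y d) + (y b - x b) * (x a * y c * y d) + (y c - x c) * (x a * x b * y d) + (y d - x d) * (x a * x b * x c)"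
    by (simp add: algebra_simps)
  ultimately show ?thesis by linarith
qed

lemma harm_ge_1: "n \<ge> 1 \<Longrightarrow> harm n \<ge> (1::real)"
  using harm_mono[of 1 n, where 'a = real] by (simp add: harm_expand)

lemma harm_le_1_plus_ln:
  assumes "n \<ge> 1"
  shows "harm n \<le> 1 + ln (real n)"
  using decseqD[OF decseq_harm_diff_ln, of 0 "n - 1"] assms by (simp add: harm_expand)

section \<open>Nonzero residues of least absolute value\<close>

definition sym_interval :: "nat \<Rightarrow> int set" where
  "sym_interval n = {- int n..int n} - {0}"

lemma finite_sym_interval: "finite (sym_interval n)"
  by (simp add: sym_interval_def)

lemma sum_sym_interval_abs: "(\<Sum>k\<in>sym_interval n. g (nat \<bar>k\<bar>)) = 2 * (\<Sum>k=1..n. g k :: real)"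
proof -
  have eq: "sym_interval n = int ` {1..n} \<union> (\<lambda>k. - int k) ` {1..n}"
  proof (intro equalityI subsetI)
    fix x assume "x \<in> sym_interval n"
    then have "nat \<bar>x\<bar> \<in> {1..n}" "x = int (nat \<bar>x\<bar>) \<or> x = - int (nat \<bar>x\<bar>)"
      by (auto simp: sym_interval_def)
    then show "x \<in> int ` {1..n} \<union> (\<lambda>k. - int k) ` {1..n}" by blast
  qed (auto simp: sym_interval_def)
  have "(\<Sum>k\<in>sym_interval n. g (nat \<bar>k\<bar>)) = (\<Sum>k\<in>int ` {1..n}. g (nat \<bar>k\<bar>)) + (\<Sum>k\<in>(\<lambda>k. - int k) ` {1..n}. g (nat \<bar>k\<bar>))"
    unfolding eq by (intro sum.union_disjoint) auto
  also have "\<dots> = 2 * (\<Sum>k=1..n. g k)"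
    by (simp add: sum.reindex inj_on_def)
  finally show ?thesis .
qed

lemma sum_sym_interval_inverse: "(\<Sum>k\<in>sym_interval n. 1 / \<bar>real_of_int k\<bar>) = 2 * harm n"
proof -
  have "1 / \<bar>real_of_int k\<bar> = 1 / real (nat \<bar>k\<bar>)" for k by simp
  then show ?thesis
    using sum_sym_interval_abs[of "\<lambda>k. 1 / real k" n] by (simp add: harm_def inverse_eq_divide)
qed

context odd_prime
begin

definition half :: nat where "half = (p - 1) div 2"

lemma p_eq: "p = 2 * half + 1"
  using odd unfolding half_def by (elim oddE) simp

lemma half_ge_1: "half \<ge> 1"
  using p_eq prime prime_ge_2_nat[of p] by simp

abbreviation "R \<equiv> sym_interval half"

lemma sum_units_eq_sym:
  assumes "periodic g"
  shows "(\<Sum>k\<in>units. g k) = (\<Sum>k\<in>R. g k)"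
proof (rule sum.reindex_bij_witness[where i = "\<lambda>x. if x > 0 then x else x + int p"
      and j = "\<lambda>x. if x \<le> int half then x else x - int p"], goal_cases)
  case (5 x)
  have "[x - int p = x] (mod int p)" by (simp add: cong_iff_dvd_diff)
  then show ?case using periodic_cong[OF assms] by auto
qed (use p_eq in \<open>auto simp: units_def sym_interval_def\<close>)

lemma cong_product_periodic:
  assumes "[x = y] (mod int p)"
  shows "[x * l = z] (mod int p) \<longleftrightarrow> [y * l = z] (mod int p)"
    "[l * x = z] (mod int p) \<longleftrightarrow> [l * y = z] (mod int p)"
    "[z = x * l] (mod int p) \<longleftrightarrow> [z = y * l] (mod int p)"
    "[z = l * x] (mod int p) \<longleftrightarrow> [z = l * y] (mod int p)"
  by (meson assms cong_scalar_left cong_scalar_right cong_sym cong_trans)+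

definition diag :: "(int \<times> int \<times> int \<times> int) set" where
  "diag = {(k, l, m, n). k \<in> R \<and> l \<in> R \<and> m \<in> R \<and> n \<in> R \<and> k * l = m * n}"

definition off_diag :: "(int \<times> int \<times> int \<times> int) set" where
  "off_diag = {(k, l, m, n). k \<in> R \<and> l \<in> R \<and> m \<in> R \<and> n \<in> R \<and> [k * l = m * n] (mod int p) \<and> k * l \<noteq> m * n}"

lemma finite_diag: "finite diag" and finite_off_diag: "finite off_diag"
  by (rule finite_subset[of _ "R \<times> R \<times> R \<times> R"]; auto simp: diag_def off_diag_def finite_sym_interval)+

lemma quad_eq_diag_off_diag:
  assumes f: "periodic f"
  shows "quad f = (\<Sum>(k, l, m, n)\<in>diag. f k * f l * f m * f n) + (\<Sum>(k, l, m, n)\<in>off_diag. f k * f l * f m * f n)"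
proof -
  let ?F = "\<lambda>k l m n. of_bool [k * l = m * n] (mod int p) * (f k * f l * f m * f n)"
  have "quad f = (\<Sum>k\<in>units. \<Sum>l\<in>units. \<Sum>m\<in>units. \<Sum>n\<in>R. ?F k l m n)"
    unfolding quad_def by (intro sum.cong refl sum_units_eq_sym periodicI)
      (simp add: cong_product_periodic periodic_cong[OF f])
  also have "\<dots> = (\<Sum>k\<in>units. \<Sum>l\<in>units. \<Sum>m\<in>R. \<Sum>n\<in>R. ?F k l m n)"
    by (intro sum.cong refl sum_units_eq_sym periodicI)
      (simp add: cong_product_periodic periodic_cong[OF f])
  also have "\<dots> = (\<Sum>k\<in>units. \<Sum>l\<in>R. \<Sum>m\<in>R. \<Sum>n\<in>R. ?F k l m n)"
    by (intro sum.cong refl sum_units_eq_sym periodicI)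
      (simp add: cong_product_periodic periodic_cong[OF f])
  also have "\<dots> = (\<Sum>k\<in>R. \<Sum>l\<in>R. \<Sum>m\<in>R. \<Sum>n\<in>R. ?F k l m n)"
    by (intro sum_units_eq_sym periodicI)
      (simp add: cong_product_periodic periodic_cong[OF f])
  also have "\<dots> = (\<Sum>(k, l, m, n)\<in>R \<times> R \<times> R \<times> R. ?F k l m n)"
    by (simp add: sum.cartesian_product)
  also have "\<dots> = (\<Sum>(k, l, m, n)\<in>diag \<union> off_diag. f k * f l * f m * f n)"
    by (intro sum.mono_neutral_cong_right) (auto simp: diag_def off_diag_def finite_sym_interval)
  also have "\<dots> = (\<Sum>(k, l, m, n)\<in>diag. f k * f l * f m * f n) + (\<Sum>(k, l, m, n)\<in>off_diag. f k * f l * f m * f n)"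
    by (intro sum.union_disjoint finite_diag finite_off_diag) (auto simp: diag_def off_diag_def)
  finally show ?thesis .
qed

lemma cotp_bounds:
  assumes "1 \<le> k" "k \<le> half"
  shows "0 \<le> cotp (int k)" "cotp (int k) \<le> real p / pi / real k" "real p / pi / real k - cotp (int k) \<le> 1"
proof -
  define x where "x = pi * real k / real p"
  have "2 * real k < real p" using assms p_eq by simp
  then have x: "0 < x" "x < pi / 2"
    using assms p_pos by (auto simp: x_def field_simps)
  have e: "cotp (int k) = cot x" "real p / pi / real k = 1 / x"
    by (simp_all add: cotp_def x_def)
  show "0 \<le> cotp (int k)" "cotp (int k) \<le> real p / pi / real k" "real p / pi / real k - cotp (int k) \<le> 1"
    unfolding e using cot_bounds[OF x] by auto
qed

lemma abs_cotp_le: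
  assumes "k \<in> R"
  shows "\<bar>cotp k\<bar> \<le> real p / pi / \<bar>real_of_int k\<bar>"
proof -
  have k: "1 \<le> nat \<bar>k\<bar>" "nat \<bar>k\<bar> \<le> half" using assms by (auto simp: sym_interval_def)
  have "\<bar>cotp k\<bar> = \<bar>cotp (int (nat \<bar>k\<bar>))\<bar>"
    by (cases "k \<ge> 0") (auto simp: cotp_minus)
  also have "\<dots> \<le> real p / pi / real (nat \<bar>k\<bar>)"
    using cotp_bounds[OF k] by simp
  finally show ?thesis by simp
qed

text \<open>The signs of k, l, m are free and give the factor 8; the sign of n must then be their
  product. The four signs multiply to 1, so the odd function \<open>cotp\<close> yields the same
  product as at the absolute values.\<close>

lemma sum_diag_eq:
  "(\<Sum>(k, l, m, n)\<in>diag. cotp k * cotp l * cotp m * cotp n)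
     = 8 * (\<Sum>(k, l, m, n)\<in>quadruples half. cotp (int k) * cotp (int l) * cotp (int m) * cotp (int n))"
proof -
  let ?G = "\<lambda>(k, l, m, n). cotp (int k) * cotp (int l) * cotp (int m) * cotp (int n)"
  let ?s = "{- 1, 1} :: int set"
  have "(\<Sum>(k, l, m, n)\<in>diag. cotp k * cotp l * cotp m * cotp n) = (\<Sum>(e, x)\<in>(?s \<times> ?s \<times> ?s) \<times> quadruples half. ?G x)"
  proof (rule sum.reindex_bij_witness[where
        i = "\<lambda>((s, t, u), (k, l, m, n)). (s * int k, t * int l, u * int m, s * t * u * int n)" and
        j = "\<lambda>(k, l, m, n). ((sgn k, sgn l, sgn m), (nat \<bar>k\<bar>, nat \<bar>l\<bar>, nat \<bar>m\<bar>, nat \<bar>n\<bar>))"], goal_cases)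
    case (1 x)
    then obtain k l m n where x: "x = (k, l, m, n)" "k \<noteq> 0" "l \<noteq> 0" "m \<noteq> 0" "n \<noteq> 0" "k * l = m * n"
      by (auto simp: diag_def sym_interval_def)
    have "sgn k * sgn l = sgn m * sgn n" using x by (metis sgn_mult)
    then have "sgn n = sgn k * sgn l * sgn m" using x by (auto simp: sgn_if split: if_splits)
    then show ?case by (simp add: x(1) sgn_mult_abs flip: \<open>sgn n = _\<close>)
  next
    case (2 x)
    then obtain k l m n where x: "x = (k, l, m, n)" "k \<in> R" "l \<in> R" "m \<in> R" "n \<in> R" "k * l = m * n"
      by (auto simp: diag_def)
    have "nat \<bar>k\<bar> * nat \<bar>l\<bar> = nat \<bar>m\<bar> * nat \<bar>n\<bar>"
      using x by (metis abs_ge_zero abs_mult nat_mult_distrib)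
    moreover have *: "nat \<bar>y\<bar> \<in> {1..half}" "sgn y \<in> ?s" if "y \<in> R" for y
      using that by (auto simp: sym_interval_def sgn_if)
    ultimately have "(nat \<bar>k\<bar>, nat \<bar>l\<bar>, nat \<bar>m\<bar>, nat \<bar>n\<bar>) \<in> quadruples half"
      using x *(1) unfolding quadruples_def by blast
    then show ?case
      using *(2)[OF x(2)] *(2)[OF x(3)] *(2)[OF x(4)] by (simp only: x(1) prod.case mem_Sigma_iff)
  next
    case (3 y)
    then obtain s t u k l m n where y: "y = ((s, t, u), (k, l, m, n))" "s \<in> ?s" "t \<in> ?s" "u \<in> ?s"
       "k \<in> {1..half}" "l \<in> {1..half}" "m \<in> {1..half}" "n \<in> {1..half}"
      unfolding quadruples_def by blast
    have *: "sgn (e * int z) = e" "nat \<bar>e * int z\<bar> = z" if "e \<in> ?s" "z \<in> {1..half}" for e z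
      using that by (auto simp: sgn_mult abs_mult)
    have "s * t * u \<in> ?s" using y by auto
    then show ?case using y by (simp only: prod.case *)
  next
    case (4 y)
    then obtain s t u k l m n where y: "y = ((s, t, u), (k, l, m, n))" "s \<in> ?s" "t \<in> ?s" "u \<in> ?s"
       "k \<in> {1..half}" "l \<in> {1..half}" "m \<in> {1..half}" "n \<in> {1..half}" "k * l = m * n"
      unfolding quadruples_def by blast
    have *: "e * int z \<in> R" if "e \<in> ?s" "z \<in> {1..half}" for e z
      using that by (auto simp: sym_interval_def)
    have "s * t * u \<in> ?s" "u * u = 1" using y by auto
    moreover have "int k * int l = int m * int n" using y(9) by (metis of_nat_mult)
    then have "(s * int k) * (t * int l) = (s * t) * (u * u) * (int m * int n)" using \<open>u * u = 1\<close>
      by (simp add: mult_ac)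
    then have "(s * int k) * (t * int l) = (u * int m) * (s * t * u * int n)"
      by (simp only: mult_ac)
    ultimately show ?case
      using y(2-8) * unfolding y(1) diag_def by (simp only: prod.case mem_Collect_eq simp_thms)
  next
    case (5 x)
    then obtain k l m n where x: "x = (k, l, m, n)" "k \<noteq> 0" "l \<noteq> 0" "m \<noteq> 0" "n \<noteq> 0" "k * l = m * n"
      by (auto simp: diag_def sym_interval_def)
    have c: "cotp y = sgn (real_of_int y) * cotp (int (nat \<bar>y\<bar>))" for y
      by (cases "y > 0"; cases "y = 0") (auto simp: cotp_minus sgn_if, simp add: cotp_def cot_def)
    have "sgn (real_of_int k) * sgn (real_of_int l) = sgn (real_of_int m) * sgn (real_of_int n)"
      using x(6) by (metis sgn_mult of_int_mult)
    then have "sgn (real_of_int k) * sgn (real_of_int l) * sgn (real_of_int m) * sgn (real_of_int n) = 1"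
      using x by (auto simp: sgn_if split: if_splits)
    then have "(sgn (real_of_int k) * cotp (int (nat \<bar>k\<bar>))) * (sgn (real_of_int l) * cotp (int (nat \<bar>l\<bar>))) * (sgn (real_of_int m) * cotp (int (nat \<bar>m\<bar>))) * (sgn (real_of_int n) * cotp (int (nat \<bar>n\<bar>)))
      = cotp (int (nat \<bar>k\<bar>)) * cotp (int (nat \<bar>l\<bar>)) * cotp (int (nat \<bar>m\<bar>)) * cotp (int (nat \<bar>n\<bar>))"
      by algebra
    then show ?case by (simp only: x(1) prod.case c[of k] c[of l] c[of m] c[of n])
  qed
  also have "\<dots> = (\<Sum>e\<in>?s \<times> ?s \<times> ?s. \<Sum>x\<in>quadruples half. ?G x)"
    by (rule sum.cartesian_product[symmetric])
  also have "\<dots> = 8 * (\<Sum>x\<in>quadruples half. ?G x)"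
    by (simp add: card_cartesian_product)
  finally show ?thesis .
qed

section \<open>Main and error terms, given a bound D for the divisor function up to p^2\<close>

context
  fixes D :: real
  assumes D: "\<And>n. 0 < n \<Longrightarrow> n \<le> p\<^sup>2 \<Longrightarrow> real (card {d. d dvd n}) \<le> D"
begin

lemma D_ge_1: "D \<ge> 1"
  using D[of 1] p_pos by simp

lemma half_product_le: "k \<le> half \<Longrightarrow> l \<le> half \<Longrightarrow> k * l \<le> p\<^sup>2"
  unfolding power2_eq_square using p_eq by (intro mult_le_mono) auto

text \<open>For given k and l there are at most D choices of (m, n), and the double sum of 1 / (k l)
  is a squared harmonic number.\<close>

lemma sum_quadruples_inverse_le:
  "(\<Sum>(k, l, m, n)\<in>quadruples half. 1 / (real k * real l)) \<le> D * (harm p)\<^sup>2"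
proof -
  define T where "T x = {(m, n). m \<in> {1..half} \<and> n \<in> {1..half} \<and> m * n = fst x * snd x}" for x :: "nat \<times> nat"
  have finT: "finite (T x)" for x
    by (rule finite_subset[of _ "{1..half} \<times> {1..half}"]) (auto simp: T_def)
  have "(\<Sum>(k, l, m, n)\<in>quadruples half. 1 / (real k * real l))
     = (\<Sum>(x, y)\<in>Sigma ({1..half} \<times> {1..half}) T. 1 / (real (fst x) * real (snd x)))"
    by (rule sum.reindex_bij_witness[where i = "\<lambda>((k, l), (m, n)). (k, l, m, n)" and j = "\<lambda>(k, l, m, n). ((k, l), (m, n))"])
       (auto simp: quadruples_def T_def)
  also have "\<dots> = (\<Sum>x\<in>{1..half} \<times> {1..half}. \<Sum>y\<in>T x. 1 / (real (fst x) * real (snd x)))"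
    by (subst sum.Sigma) (auto simp: finT)
  also have "\<dots> = (\<Sum>x\<in>{1..half} \<times> {1..half}. real (card (T x)) * (1 / (real (fst x) * real (snd x))))"
    by simp
  also have "\<dots> \<le> (\<Sum>x\<in>{1..half} \<times> {1..half}. D * (1 / (real (fst x) * real (snd x))))"
  proof (intro sum_mono mult_right_mono)
    fix x assume x: "x \<in> {1..half} \<times> {1..half}"
    then have "0 < fst x * snd x" "fst x * snd x \<le> p\<^sup>2"
      by (auto intro: half_product_le)
    then show "real (card (T x)) \<le> D"
      using D card_nat_factorizations_le[of "fst x * snd x" "{1..half}"] unfolding T_def
      by (meson of_nat_mono order_trans)
  qed auto
  also have "\<dots> = D * (\<Sum>x\<in>{1..half} \<times> {1..half}. 1 / (real (fst x) * real (snd x)))"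
    by (rule sum_distrib_left[symmetric])
  also have "(\<Sum>x\<in>{1..half} \<times> {1..half}. 1 / (real (fst x) * real (snd x))) = (harm half)\<^sup>2"
    unfolding harm_def power2_eq_square sum_product sum.cartesian_product
    by (intro sum.cong) (auto simp: inverse_eq_divide)
  also have "D * (harm half)\<^sup>2 \<le> D * (harm p)\<^sup>2"
    using D_ge_1 p_eq by (intro mult_left_mono power_mono harm_mono harm_nonneg) auto
  finally show ?thesis .
qed

text \<open>Replacing each cotangent by c / k with c = p / pi leaves four products of three factors.
  Since k l = m n, each is at most c^3 / (k l); the constant 32 is 4 terms times 8 sign
  patterns.\<close>

lemma sum_diag_estimate:
  "\<bar>(\<Sum>(k, l, m, n)\<in>diag. cotp k * cotp l * cotp m * cotp n)
      - 8 * (real p / pi) ^ 4 * (\<Sum>(k, l, m, n)\<in>quadruples half. 1 / (real k * real l * real m * real n))\<bar>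
    \<le> 32 * (real p / pi) ^ 3 * (D * (harm p)\<^sup>2)"
proof -
  define c where "c = real p / pi"
  have c: "c > 0" using p_pos by (simp add: c_def)
  \<comment> \<open>Both functions are set to 0 outside the range because
    \<open>prod4_diff_le\<close> asks for its bounds at every index.\<close>
  define x where "x k = (if k \<in> {1..half} then cotp (int k) else 0)" for k :: nat
  define y where "y k = (if k \<in> {1..half} then c / real k else 0)" for k :: nat
  have xy: "0 \<le> x k" "x k \<le> y k" "y k - x k \<le> 1" for k
    using cotp_bounds[of k] unfolding x_def y_def c_def by auto
  have est: "\<bar>cotp (int k) * cotp (int l) * cotp (int m) * cotp (int n) - c ^ 4 * (1 / (real k * real l * real m * real n))\<bar>
     \<le> 4 * c ^ 3 * (1 / (real k * real l))" if "(k, l, m, n) \<in> quadruples half" for k l m n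
  proof -
    have q: "k \<in> {1..half}" "l \<in> {1..half}" "m \<in> {1..half}" "n \<in> {1..half}" "k * l = m * n"
      using that by (auto simp: quadruples_def)
    have mn: "real m * real n = real k * real l" using q(5) by (metis of_nat_mult)
    have pos: "real k \<ge> 1" "real l \<ge> 1" "real m \<ge> 1" "real n \<ge> 1" using q by auto
    have "cotp (int k) * cotp (int l) * cotp (int m) * cotp (int n) = x k * x l * x m * x n"
      using q by (simp add: x_def)
    moreover have "c ^ 4 * (1 / (real k * real l * real m * real n)) = y k * y l * y m * y n"
      using q by (simp add: y_def eval_nat_numeral)
    ultimately have "\<bar>cotp (int k) * cotp (int l) * cotp (int m) * cotp (int n) - c ^ 4 * (1 / (real k * real l * real m * real n))\<bar>
      \<le> y l * y m * y n + y k * y m * y n + y k * y l * y n + y k * y l * y m"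
      using prod4_diff_le[OF xy, where a = k and b = l and c = m and d = n] by simp
    also have "\<dots> = c ^ 3 * (1 / (real l * (real m * real n)) + 1 / (real k * (real m * real n)) + 1 / (real k * real l * real n) + 1 / (real k * real l * real m))"
      using q by (simp add: y_def eval_nat_numeral distrib_left mult_ac)
    also have "\<dots> \<le> c ^ 3 * (1 / (real k * real l) + 1 / (real k * real l) + 1 / (real k * real l) + 1 / (real k * real l))"
    proof -
      \<comment> \<open>Using m n = k l, every product of three variables is k l times one further
        variable z, and z is at least 1.\<close>
      have gen: "1 / (z * (real k * real l)) \<le> 1 / (real k * real l)" if "z \<ge> 1" for z
        using that pos mult_right_mono[of 1 z "real k * real l"] by (intro divide_left_mono mult_pos_pos) auto
      show ?thesis unfolding mn
        using gen[OF pos(1)] gen[OF pos(2)] gen[OF pos(3)] gen[OF pos(4)] c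
        by (intro mult_left_mono add_mono) (auto simp: mult_ac)
    qed
    finally show ?thesis by (simp add: mult_ac)
  qed
  define X where "X = (\<Sum>(k, l, m, n)\<in>quadruples half. cotp (int k) * cotp (int l) * cotp (int m) * cotp (int n))"
  define Y where "Y = (\<Sum>(k, l, m, n)\<in>quadruples half. 1 / (real k * real l * real m * real n))"
  have "X - c ^ 4 * Y = (\<Sum>(k, l, m, n)\<in>quadruples half.
      cotp (int k) * cotp (int l) * cotp (int m) * cotp (int n) - c ^ 4 * (1 / (real k * real l * real m * real n)))"
    unfolding X_def Y_def sum_distrib_left sum_subtractf[symmetric] by (simp add: case_prod_beta)
  also have "\<bar>\<dots>\<bar> \<le> (\<Sum>(k, l, m, n)\<in>quadruples half. 4 * c ^ 3 * (1 / (real k * real l)))"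
  proof (intro order_trans[OF sum_abs] sum_mono)
    fix x assume x: "x \<in> quadruples half"
    obtain k l m n where "x = (k, l, m, n)" by (cases x)
    with est x show "\<bar>case x of (k, l, m, n) \<Rightarrow> cotp (int k) * cotp (int l) * cotp (int m) * cotp (int n)
          - c ^ 4 * (1 / (real k * real l * real m * real n))\<bar>
        \<le> (case x of (k, l, m, n) \<Rightarrow> 4 * c ^ 3 * (1 / (real k * real l)))"
      by (simp only: prod.case)
  qed
  finally have "8 * \<bar>X - c ^ 4 * Y\<bar> \<le> 8 * (\<Sum>(k, l, m, n)\<in>quadruples half. 4 * c ^ 3 * (1 / (real k * real l)))"
    by (rule mult_left_mono) simp
  also have "\<dots> = 32 * c ^ 3 * (\<Sum>(k, l, m, n)\<in>quadruples half. 1 / (real k * real l))"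
    by (simp add: sum_distrib_left case_prod_beta)
  also have "\<dots> \<le> 32 * c ^ 3 * (D * (harm p)\<^sup>2)"
    using c by (intro mult_left_mono sum_quadruples_inverse_le) auto
  finally have *: "8 * \<bar>X - c ^ 4 * Y\<bar> \<le> 32 * c ^ 3 * (D * (harm p)\<^sup>2)" .
  have "\<bar>8 * X - 8 * c ^ 4 * Y\<bar> \<le> 32 * c ^ 3 * (D * (harm p)\<^sup>2)"
  proof -
    have "8 * X - 8 * c ^ 4 * Y = 8 * (X - c ^ 4 * Y)" by (simp add: algebra_simps)
    then have "\<bar>8 * X - 8 * c ^ 4 * Y\<bar> = 8 * \<bar>X - c ^ 4 * Y\<bar>"
      by (simp only: abs_mult abs_numeral)
    with * show ?thesis by (simp only:)
  qed
  then show ?thesis unfolding sum_diag_eq X_def Y_def c_def .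
qed

text \<open>Write u - m n = p j. Then j is nonzero and at most p in absolute value, and each j
  occurs for at most 2 D pairs. The reciprocals of p j thus sum to at most 2 D / p times twice a
  harmonic number.\<close>

lemma sum_off_diag_fibre_le:
  fixes u :: int
  assumes u: "\<bar>u\<bar> \<le> (int half)\<^sup>2"
  shows "(\<Sum>(m, n) | m \<in> R \<and> n \<in> R \<and> [u = m * n] (mod int p) \<and> u \<noteq> m * n. 1 / \<bar>real_of_int (u - m * n)\<bar>)
     \<le> 4 * D * harm p / real p"
proof -
  define A where "A = {(m, n). m \<in> R \<and> n \<in> R \<and> [u = m * n] (mod int p) \<and> u \<noteq> m * n}"
  define j where "j x = (u - fst x * snd x) div int p" for x
  have finA: "finite A"
    by (rule finite_subset[of _ "R \<times> R"]) (auto simp: A_def finite_sym_interval)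
  have jA: "int p * j x = u - fst x * snd x" if "x \<in> A" for x
    using that unfolding A_def j_def by (auto simp: cong_iff_dvd_diff)
  have prod_le: "\<bar>m * n\<bar> \<le> (int half)\<^sup>2" if "m \<in> R" "n \<in> R" for m n
    unfolding abs_mult power2_eq_square using that by (intro mult_mono) (auto simp: sym_interval_def)
  have sub: "j ` A \<subseteq> sym_interval p"
  proof
    fix i assume "i \<in> j ` A"
    then obtain m n where x: "(m, n) \<in> A" "i = j (m, n)" by auto
    have eq: "int p * i = u - m * n" using jA[OF x(1)] x(2) by simp
    have "\<bar>m * n\<bar> \<le> (int half)\<^sup>2" using x(1) prod_le by (auto simp: A_def)
    moreover have "\<bar>int p * i\<bar> \<le> \<bar>u\<bar> + \<bar>m * n\<bar>"
      unfolding eq by (rule abs_triangle_ineq4)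
    moreover have "\<bar>int p * i\<bar> = int p * \<bar>i\<bar>" by (simp add: abs_mult)
    ultimately have "int p * \<bar>i\<bar> \<le> 2 * (int half)\<^sup>2"
      using u by linarith
    also have "\<dots> \<le> int p * int p"
    proof -
      have "2 * (int half)\<^sup>2 \<le> (2 * int half + 1) * (2 * int half + 1)"
        by (simp add: algebra_simps power2_eq_square)
      also have "2 * int half + 1 = int p" using p_eq by linarith
      finally show ?thesis .
    qed
    finally have "\<bar>i\<bar> \<le> int p" using p_pos by simp
    moreover have "i \<noteq> 0" using eq x(1) by (auto simp: A_def)
    ultimately show "i \<in> sym_interval p" by (auto simp: sym_interval_def)
  qed
  have "(\<Sum>(m, n)\<in>A. 1 / \<bar>real_of_int (u - m * n)\<bar>) = (\<Sum>x\<in>A. 1 / (real p * \<bar>real_of_int (j x)\<bar>))"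
  proof (intro sum.cong refl)
    fix x assume "x \<in> A"
    then have "real_of_int (u - fst x * snd x) = real p * real_of_int (j x)"
      by (simp only: jA[symmetric] of_int_mult of_int_of_nat_eq)
    then show "(case x of (m, n) \<Rightarrow> 1 / \<bar>real_of_int (u - m * n)\<bar>) = 1 / (real p * \<bar>real_of_int (j x)\<bar>)"
      by (simp only: case_prod_beta abs_mult abs_of_nat)
  qed
  also have "\<dots> = (\<Sum>i\<in>sym_interval p. \<Sum>x | x \<in> A \<and> j x = i. 1 / (real p * \<bar>real_of_int (j x)\<bar>))"
    by (rule sum.group[symmetric]) (auto simp: finA finite_sym_interval sub)
  also have "\<dots> \<le> (\<Sum>i\<in>sym_interval p. 2 * D * (1 / (real p * \<bar>real_of_int i\<bar>)))"
  proof (rule sum_mono)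
    fix i
    define v where "v = u - int p * i"
    \<comment> \<open>All pairs over i have the same product v. An empty fibre is treated apart
      because only a member shows that v is nonzero and small enough for the divisor bound.\<close>
    have "real (card {x \<in> A. j x = i}) \<le> 2 * D"
    proof (cases "{x \<in> A. j x = i} = {}")
      case True
      then show ?thesis using D_ge_1 by (simp only: card.empty)
    next
      case False
      then obtain m n where mn: "(m, n) \<in> A" "j (m, n) = i" by auto
      have v: "v = m * n" using jA[OF mn(1)] mn(2) by (simp add: v_def)
      have v0: "v \<noteq> 0" using mn(1) v by (auto simp: A_def sym_interval_def)
      have "\<bar>v\<bar> \<le> (int half)\<^sup>2" unfolding v using mn(1) prod_le by (auto simp: A_def)
      then have "nat \<bar>v\<bar> \<le> half\<^sup>2" by (simp add: nat_le_iff)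
      also have "\<dots> \<le> p\<^sup>2" using half_product_le[of half half] by (simp add: power2_eq_square)
      finally have vp: "nat \<bar>v\<bar> \<le> p\<^sup>2" .
      have "{x \<in> A. j x = i} \<subseteq> {(m, n). m \<in> R \<and> n \<in> R \<and> m * n = v}"
      proof
        fix x assume x: "x \<in> {x \<in> A. j x = i}"
        then have "fst x * snd x = v" using jA[of x] by (simp add: v_def)
        then show "x \<in> {(m, n). m \<in> R \<and> n \<in> R \<and> m * n = v}"
          using x by (auto simp: A_def)
      qed
      then have "card {x \<in> A. j x = i} \<le> card {(m, n). m \<in> R \<and> n \<in> R \<and> m * n = v}"
        by (rule card_mono[rotated]) (rule finite_subset[of _ "R \<times> R"], auto simp: finite_sym_interval)
      also have "\<dots> \<le> 2 * card {d. d dvd nat \<bar>v\<bar>}"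
        by (rule card_int_factorizations_le) fact
      finally have "real (card {x \<in> A. j x = i}) \<le> 2 * real (card {d. d dvd nat \<bar>v\<bar>})"
        by linarith
      also have "\<dots> \<le> 2 * D"
        using D[of "nat \<bar>v\<bar>"] v0 vp by simp
      finally show ?thesis .
    qed
    then have "real (card {x \<in> A. j x = i}) * (1 / (real p * \<bar>real_of_int i\<bar>)) \<le> 2 * D * (1 / (real p * \<bar>real_of_int i\<bar>))"
      by (intro mult_right_mono) auto
    moreover have "(\<Sum>x | x \<in> A \<and> j x = i. 1 / (real p * \<bar>real_of_int (j x)\<bar>)) = real (card {x \<in> A. j x = i}) * (1 / (real p * \<bar>real_of_int i\<bar>))"
      by simp
    ultimately show "(\<Sum>x | x \<in> A \<and> j x = i. 1 / (real p * \<bar>real_of_int (j x)\<bar>)) \<le> 2 * D * (1 / (real p * \<bar>real_of_int i\<bar>))"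
      by linarith
  qed
  also have "\<dots> = 2 * D / real p * (\<Sum>i\<in>sym_interval p. 1 / \<bar>real_of_int i\<bar>)"
    by (simp add: sum_distrib_left)
  also have "\<dots> = 4 * D * harm p / real p"
    unfolding sum_sym_interval_inverse by simp
  finally show ?thesis unfolding A_def .
qed

text \<open>Exchanging (k, l) with (m, n) makes the two halves of the upper bound equal. For fixed
  (k, l) the fibre estimate applies, and the outer sum is (2 harm)^2, whence 2 * 4 * 4 = 32.\<close>

lemma sum_off_diag_inverse_le:
  "(\<Sum>(k, l, m, n)\<in>off_diag. 1 / \<bar>real_of_int (k * l) * real_of_int (m * n)\<bar>) \<le> 32 * D * harm p ^ 3 / real p"
proof -
  define B where "B x = {(m, n). m \<in> R \<and> n \<in> R \<and> [fst x * snd x = m * n] (mod int p) \<and> fst x * snd x \<noteq> m * n}" for x :: "int \<times> int"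
  have finB: "finite (B x)" for x
    by (rule finite_subset[of _ "R \<times> R"]) (auto simp: B_def finite_sym_interval)
  define W where "W = (\<Sum>(k, l, m, n)\<in>off_diag. 1 / (\<bar>real_of_int (k * l)\<bar> * \<bar>real_of_int (k * l - m * n)\<bar>))"
  have W_swap: "(\<Sum>(k, l, m, n)\<in>off_diag. 1 / (\<bar>real_of_int (m * n)\<bar> * \<bar>real_of_int (k * l - m * n)\<bar>)) = W"
    unfolding W_def
    by (rule sum.reindex_bij_witness[where i = "\<lambda>(k, l, m, n). (m, n, k, l)" and j = "\<lambda>(k, l, m, n). (m, n, k, l)"])
       (auto simp: off_diag_def cong_sym_eq abs_minus_commute)
  have "(\<Sum>(k, l, m, n)\<in>off_diag. 1 / \<bar>real_of_int (k * l) * real_of_int (m * n)\<bar>)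
     \<le> (\<Sum>(k, l, m, n)\<in>off_diag. 1 / (\<bar>real_of_int (k * l)\<bar> * \<bar>real_of_int (k * l - m * n)\<bar>)
           + 1 / (\<bar>real_of_int (m * n)\<bar> * \<bar>real_of_int (k * l - m * n)\<bar>))"
  proof (rule sum_mono)
    fix x assume "x \<in> off_diag"
    then obtain k l m n where x: "x = (k, l, m, n)" "k * l \<noteq> m * n" "k * l \<noteq> 0" "m * n \<noteq> 0"
      by (auto simp: off_diag_def sym_interval_def)
    \<comment> \<open>This is the triangle inequality for a - b divided by the product of the three
      absolute values.\<close>
    have gen: "1 / \<bar>a * b\<bar> \<le> 1 / (\<bar>a\<bar> * \<bar>a - b\<bar>) + 1 / (\<bar>b\<bar> * \<bar>a - b\<bar>)" if "a \<noteq> b" "a \<noteq> 0" "b \<noteq> 0" for a b :: real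
    proof -
      have "1 / (\<bar>a\<bar> * \<bar>a - b\<bar>) + 1 / (\<bar>b\<bar> * \<bar>a - b\<bar>) = (\<bar>a\<bar> + \<bar>b\<bar>) / \<bar>a - b\<bar> * (1 / \<bar>a * b\<bar>)"
        using that by (simp add: divide_simps abs_mult)
      moreover have "1 \<le> (\<bar>a\<bar> + \<bar>b\<bar>) / \<bar>a - b\<bar>"
        using that by (simp add: le_divide_eq abs_triangle_ineq4)
      then have "1 * (1 / \<bar>a * b\<bar>) \<le> (\<bar>a\<bar> + \<bar>b\<bar>) / \<bar>a - b\<bar> * (1 / \<bar>a * b\<bar>)"
        by (intro mult_right_mono) auto
      ultimately show ?thesis by simp
    qed
    show "(case x of (k, l, m, n) \<Rightarrow> 1 / \<bar>real_of_int (k * l) * real_of_int (m * n)\<bar>)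
       \<le> (case x of (k, l, m, n) \<Rightarrow> 1 / (\<bar>real_of_int (k * l)\<bar> * \<bar>real_of_int (k * l - m * n)\<bar>)
           + 1 / (\<bar>real_of_int (m * n)\<bar> * \<bar>real_of_int (k * l - m * n)\<bar>))"
      using gen[of "real_of_int (k * l)" "real_of_int (m * n)"] x(2-4)
      unfolding x(1) prod.case of_int_diff of_int_eq_iff of_int_eq_0_iff by blast
  qed
  also have "\<dots> = 2 * W"
    unfolding W_swap[symmetric] case_prod_beta sum.distrib using W_swap by (simp add: W_def case_prod_beta)
  also have "W = (\<Sum>(x, y)\<in>Sigma (R \<times> R) B. 1 / \<bar>real_of_int (fst x * snd x)\<bar> * (1 / \<bar>real_of_int (fst x * snd x - fst y * snd y)\<bar>))"
    unfolding W_def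
    by (rule sum.reindex_bij_witness[where i = "\<lambda>((k, l), (m, n)). (k, l, m, n)" and j = "\<lambda>(k, l, m, n). ((k, l), (m, n))"])
       (auto simp: off_diag_def B_def)
  also have "\<dots> = (\<Sum>x\<in>R \<times> R. \<Sum>y\<in>B x. 1 / \<bar>real_of_int (fst x * snd x)\<bar> * (1 / \<bar>real_of_int (fst x * snd x - fst y * snd y)\<bar>))"
    by (subst sum.Sigma) (auto simp: finB finite_sym_interval)
  also have "\<dots> = (\<Sum>x\<in>R \<times> R. 1 / \<bar>real_of_int (fst x * snd x)\<bar> * (\<Sum>(m, n)\<in>B x. 1 / \<bar>real_of_int (fst x * snd x - m * n)\<bar>))"
    by (simp only: sum_distrib_left case_prod_beta)
  also have "\<dots> \<le> (\<Sum>x\<in>R \<times> R. 1 / \<bar>real_of_int (fst x * snd x)\<bar> * (4 * D * harm p / real p))"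
  proof (intro sum_mono mult_left_mono)
    fix x assume x: "x \<in> R \<times> R"
    have "\<bar>fst x * snd x\<bar> \<le> (int half)\<^sup>2"
      unfolding abs_mult power2_eq_square using x by (intro mult_mono) (auto simp: sym_interval_def)
    then show "(\<Sum>(m, n)\<in>B x. 1 / \<bar>real_of_int (fst x * snd x - m * n)\<bar>) \<le> 4 * D * harm p / real p"
      unfolding B_def by (rule sum_off_diag_fibre_le)
  qed auto
  also have "\<dots> = (2 * harm half)\<^sup>2 * (4 * D * harm p / real p)"
  proof -
    have "(\<Sum>x\<in>R \<times> R. 1 / \<bar>real_of_int (fst x * snd x)\<bar>) = (2 * harm half)\<^sup>2"
      unfolding sum_sym_interval_inverse[symmetric] power2_eq_square sum_product sum.cartesian_product
      by (intro sum.cong) (auto simp: abs_mult)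
    then show ?thesis by (simp only: sum_distrib_right[symmetric])
  qed
  also have "\<dots> \<le> (2 * harm p)\<^sup>2 * (4 * D * harm p / real p)"
    using D_ge_1 p_eq harm_nonneg[of p, where 'a = real]
    by (intro mult_right_mono power_mono mult_left_mono harm_mono) (auto simp: harm_nonneg)
  finally show ?thesis by (simp add: power2_eq_square eval_nat_numeral mult_ac)
qed

lemma sum_off_diag_estimate:
  "\<bar>\<Sum>(k, l, m, n)\<in>off_diag. cotp k * cotp l * cotp m * cotp n\<bar>
    \<le> (real p / pi) ^ 4 * (32 * D * harm p ^ 3 / real p)"
proof -
  define c where "c = real p / pi"
  have c: "c > 0" using p_pos by (simp add: c_def)
  have "\<bar>\<Sum>(k, l, m, n)\<in>off_diag. cotp k * cotp l * cotp m * cotp n\<bar>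
     \<le> (\<Sum>(k, l, m, n)\<in>off_diag. c ^ 4 * (1 / \<bar>real_of_int (k * l) * real_of_int (m * n)\<bar>))"
  proof (intro order_trans[OF sum_abs] sum_mono)
    fix x assume "x \<in> off_diag"
    then obtain k l m n where x: "x = (k, l, m, n)" "k \<in> R" "l \<in> R" "m \<in> R" "n \<in> R"
      by (auto simp: off_diag_def)
    have "\<bar>cotp k * cotp l * cotp m * cotp n\<bar> \<le> (c / \<bar>real_of_int k\<bar>) * (c / \<bar>real_of_int l\<bar>) * (c / \<bar>real_of_int m\<bar>) * (c / \<bar>real_of_int n\<bar>)"
      unfolding abs_mult c_def using x c by (intro mult_mono abs_cotp_le mult_nonneg_nonneg) auto
    also have "\<dots> = c ^ 4 * (1 / \<bar>real_of_int (k * l) * real_of_int (m * n)\<bar>)"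
      by (simp add: abs_mult eval_nat_numeral)
    finally show "\<bar>case x of (k, l, m, n) \<Rightarrow> cotp k * cotp l * cotp m * cotp n\<bar>
       \<le> (case x of (k, l, m, n) \<Rightarrow> c ^ 4 * (1 / \<bar>real_of_int (k * l) * real_of_int (m * n)\<bar>))"
      by (simp only: x(1) prod.case)
  qed
  also have "\<dots> = c ^ 4 * (\<Sum>(k, l, m, n)\<in>off_diag. 1 / \<bar>real_of_int (k * l) * real_of_int (m * n)\<bar>)"
    by (simp add: sum_distrib_left case_prod_beta)
  also have "\<dots> \<le> c ^ 4 * (32 * D * harm p ^ 3 / real p)"
    using c by (intro mult_left_mono sum_off_diag_inverse_le) auto
  finally show ?thesis unfolding c_def .
qed

text \<open>The main term is 8 (p / pi)^4 times 5 pi^4 / 72, in which pi cancels and 5/9 remains.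
  Three errors arise: the truncated diagonal sum, the cotangent replacement and the off-diagonal
  solutions.\<close>

lemma quad_cotp_estimate:
  "\<bar>quad cotp - 5 / 9 * real p ^ 4\<bar> \<le> 5000 * real p ^ 3 * D * harm p ^ 3"
proof -
  define c where "c = real p / pi"
  define h where "h = (harm p :: real)"
  define M where "M = (\<Sum>(k, l, m, n)\<in>quadruples half. 1 / (real k * real l * real m * real n))"
  define E where "E = real p ^ 3 * D * h ^ 3"
  have p1: "real p \<ge> 1" using p_pos by simp
  have h1: "h \<ge> 1" unfolding h_def using p_pos by (intro harm_ge_1) auto
  have c: "c > 0" "c \<le> real p" using p1 pi_gt3 by (auto simp: c_def divide_simps)
  \<comment> \<open>An odd prime has \<open>half >= p / 3\<close>, which turns 200 into 600.\<close>
  have M: "\<bar>M - 5 * pi ^ 4 / 72\<bar> \<le> 600 * h / real p"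
  proof -
    have "\<bar>M - 5 * pi ^ 4 / 72\<bar> \<le> 200 * harm half / real half"
      unfolding M_def by (rule sum_quadruples_bound[OF half_ge_1])
    also have "\<dots> \<le> 200 * h / (real p / 3)"
      unfolding h_def using half_ge_1 p_eq p_pos harm_nonneg[of p, where 'a = real]
      by (intro frac_le mult_left_mono harm_mono) auto
    finally show ?thesis by simp
  qed
  have "\<bar>8 * c ^ 4 * M - 5 / 9 * real p ^ 4\<bar> = 8 * c ^ 4 * \<bar>M - 5 * pi ^ 4 / 72\<bar>"
  proof -
    have "8 * c ^ 4 * M - 5 / 9 * real p ^ 4 = 8 * c ^ 4 * (M - 5 * pi ^ 4 / 72)"
      unfolding c_def by (simp add: power_divide algebra_simps)
    then show ?thesis using c by (simp add: abs_mult)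
  qed
  also have "\<dots> \<le> 8 * real p ^ 4 * (600 * h / real p)"
    using c M by (intro mult_mono power_mono) auto
  also have "\<dots> = 4800 * (real p ^ 3 * 1 * h)"
    using p1 by (simp add: eval_nat_numeral)
  also have "\<dots> \<le> 4800 * E"
    unfolding E_def using D_ge_1 h1 p1 self_le_power[of h 3]
    by (intro mult_left_mono mult_mono) auto
  finally have 1: "\<bar>8 * c ^ 4 * M - 5 / 9 * real p ^ 4\<bar> \<le> 4800 * E" .
  have "32 * c ^ 3 * (D * h\<^sup>2) \<le> 32 * real p ^ 3 * (D * h ^ 3)"
    using c D_ge_1 h1 by (intro mult_mono power_mono mult_left_mono power_increasing) auto
  then have 2: "\<bar>(\<Sum>(k, l, m, n)\<in>diag. cotp k * cotp l * cotp m * cotp n) - 8 * c ^ 4 * M\<bar> \<le> 32 * E"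
    using sum_diag_estimate unfolding c_def M_def h_def E_def by simp
  have "c ^ 4 * (32 * D * h ^ 3 / real p) \<le> real p ^ 4 * (32 * D * h ^ 3 / real p)"
    using c D_ge_1 h1 by (intro mult_right_mono power_mono) auto
  also have "\<dots> = 32 * E" using p1 by (simp add: E_def eval_nat_numeral)
  finally have 3: "\<bar>\<Sum>(k, l, m, n)\<in>off_diag. cotp k * cotp l * cotp m * cotp n\<bar> \<le> 32 * E"
    using sum_off_diag_estimate unfolding c_def h_def by linarith
  \<comment> \<open>The constants add up to 4800 + 32 + 32, rounded up to 5000.\<close>
  have "E \<ge> 0" unfolding E_def using D_ge_1 h1 by auto
  then have "\<bar>quad cotp - 5 / 9 * real p ^ 4\<bar> \<le> 5000 * E"
    unfolding quad_eq_diag_off_diag[OF periodic_cotp] using 1 2 3 by linarith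
  then show ?thesis unfolding E_def h_def by (simp only: mult.assoc)
qed

text \<open>The natural main term is 5/144 x^3 with x = p^2, and 5/144 is 5/9 over 16. The stated
  rational expression differs from x^3 by at most 4 x^2 = 4 p^4, well below the error of order
  p^5.\<close>

lemma sum_S_estimate:
  "\<bar>(\<Sum>d = 1..p - 1. \<bar>real (S p d) - (real p)\<^sup>2 * (real p - 1) / 4\<bar>\<^sup>2)
      - 5 / 144 * ((real p)\<^sup>2 * ((real p)\<^sup>2 - 1) ^ 3 / ((real p)\<^sup>2 + 1))\<bar>
    \<le> 400 * (real p ^ 5 * (D * harm p ^ 3))"
proof -
  define x where "x = (real p)\<^sup>2"
  define h where "h = (harm p :: real)"
  have p1: "real p \<ge> 1" using p_pos by simp
  have h1: "h \<ge> 1" unfolding h_def using p_pos by (intro harm_ge_1) auto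
  have x1: "x \<ge> 1" unfolding x_def using p1 by simp
  have "x ^ 3 - x * (x - 1) ^ 3 / (x + 1) = x * (4 * x\<^sup>2 - 3 * x + 1) / (x + 1)"
    using x1 by (simp add: field_simps power2_eq_square eval_nat_numeral)
  moreover have "0 \<le> x * (4 * x\<^sup>2 - 3 * x + 1) / (x + 1)"
  proof -
    have "x * 1 \<le> x * x" using x1 by (intro mult_left_mono) auto
    then have "4 * x\<^sup>2 - 3 * x + 1 \<ge> 0" using x1 unfolding power2_eq_square by linarith
    then show ?thesis using x1 by simp
  qed
  moreover have "x * (4 * x\<^sup>2 - 3 * x + 1) / (x + 1) \<le> 4 * x\<^sup>2"
  proof -
    have "x * (4 * x\<^sup>2 - 3 * x + 1) \<le> 4 * x\<^sup>2 * (x + 1)"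
    proof -
      have "4 * x\<^sup>2 * (x + 1) - x * (4 * x\<^sup>2 - 3 * x + 1) = 7 * (x * x) - x"
        by (simp add: algebra_simps power2_eq_square)
      moreover have "x * 1 \<le> x * x" using x1 by (intro mult_left_mono) auto
      ultimately show ?thesis using x1 by linarith
    qed
    then show ?thesis using x1 by (simp add: divide_le_eq)
  qed
  ultimately have 1: "\<bar>x ^ 3 - x * (x - 1) ^ 3 / (x + 1)\<bar> \<le> 4 * x\<^sup>2" by linarith
  have x2: "x\<^sup>2 \<le> real p ^ 5 * (D * h ^ 3)"
  proof -
    have "x\<^sup>2 = real p ^ 4 * (1 * 1 ^ 3)" by (simp add: x_def)
    also have "\<dots> \<le> real p ^ 5 * (D * h ^ 3)"
      using p1 D_ge_1 h1 by (intro mult_mono power_increasing power_mono) auto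
    finally show ?thesis .
  qed
  have "\<bar>x / 16 * quad cotp - 5 / 144 * x ^ 3\<bar> = x / 16 * \<bar>quad cotp - 5 / 9 * real p ^ 4\<bar>"
  proof -
    have "x / 16 * quad cotp - 5 / 144 * x ^ 3 = x / 16 * (quad cotp - 5 / 9 * real p ^ 4)"
      unfolding x_def by (simp add: algebra_simps flip: power_mult power_add)
    also have "\<bar>\<dots>\<bar> = x / 16 * \<bar>quad cotp - 5 / 9 * real p ^ 4\<bar>"
      unfolding abs_mult using x1 by simp
    finally show ?thesis .
  qed
  also have "\<dots> \<le> x / 16 * (5000 * real p ^ 3 * D * h ^ 3)"
    unfolding h_def using x1 by (intro mult_left_mono quad_cotp_estimate) auto
  also have "\<dots> = 5000 / 16 * (real p ^ 5 * (D * h ^ 3))"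
    unfolding x_def by (simp add: eval_nat_numeral)
  finally have 2: "\<bar>x / 16 * quad cotp - 5 / 144 * x ^ 3\<bar> \<le> 5000 / 16 * (real p ^ 5 * (D * h ^ 3))" .
  \<comment> \<open>The total constant is 5000/16 + 4 * 5/144, below 400.\<close>
  have "\<bar>q - 5 / 144 * b\<bar> \<le> 400 * e" if "\<bar>a - b\<bar> \<le> 4 * y" "\<bar>q - 5 / 144 * a\<bar> \<le> 5000 / 16 * e" "y \<le> e"
    for a b q y e :: real
    using that by linarith
  from this[OF 1 2 x2]
  have "\<bar>x / 16 * quad cotp - 5 / 144 * (x * (x - 1) ^ 3 / (x + 1))\<bar> \<le> 400 * (real p ^ 5 * (D * h ^ 3))" .
  then show ?thesis unfolding sum_S_eq_quad_cotp x_def h_def .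
qed

end

end

section \<open>Passage to an absolute constant\<close>

theorem theorem2:
  "\<exists>C::real. C > 0 \<and> (\<forall>p::nat. prime p \<longrightarrow>
     \<bar>(\<Sum>d = 1..p - 1. \<bar>real (S p d) - (real p)\<^sup>2 * (real p - 1) / 4\<bar>\<^sup>2)
        - 5 / 144 * ((real p)\<^sup>2 * ((real p)\<^sup>2 - 1) ^ 3 / ((real p)\<^sup>2 + 1))\<bar>
     \<le> C * (real p ^ 5 * exp (3 * ln (real p) / ln (ln (real p)))))"
proof -
  define L where "L p = \<bar>(\<Sum>d = 1..p - 1. \<bar>real (S p d) - (real p)\<^sup>2 * (real p - 1) / 4\<bar>\<^sup>2)
        - 5 / 144 * ((real p)\<^sup>2 * ((real p)\<^sup>2 - 1) ^ 3 / ((real p)\<^sup>2 + 1))\<bar>" for p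
  define G where "G p = real p ^ 5 * exp (3 * ln (real p) / ln (ln (real p)))" for p
  have "eventually (\<lambda>x. divisor_bound x * (1 + ln x) ^ 3 \<le> exp (3 * ln x / ln (ln x)) \<and> ln (ln x) \<ge> 1 \<and> x > 2) at_top"
    by (intro eventually_conj divisor_bound_asymp; real_asymp)
  then obtain N where N: "\<And>x. x \<ge> N \<Longrightarrow> divisor_bound x * (1 + ln x) ^ 3 \<le> exp (3 * ln x / ln (ln x)) \<and> ln (ln x) \<ge> 1 \<and> x > 2"
    by (auto simp: eventually_at_top_linorder)
  have large: "L p \<le> 400 * G p" if p: "prime p" "real p \<ge> N" for p
  proof -
    have Np: "divisor_bound (real p) * (1 + ln (real p)) ^ 3 \<le> exp (3 * ln (real p) / ln (ln (real p)))"
      "ln (ln (real p)) \<ge> 1" "real p > 2"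
      using N[OF p(2)] by auto
    interpret odd_prime p
      using p(1) Np(3) prime_odd_nat[of p] by unfold_locales auto
    have D: "real (card {d. d dvd n}) \<le> divisor_bound (real p)" if "0 < n" "n \<le> p\<^sup>2" for n
    proof (rule card_divisors_le_divisor_bound)
      show "real n \<le> (real p)\<^sup>2" using that(2) by (metis of_nat_le_iff of_nat_power)
    qed (use Np that in auto)
    have "L p \<le> 400 * (real p ^ 5 * (divisor_bound (real p) * harm p ^ 3))"
      unfolding L_def by (rule sum_S_estimate[OF D])
    also have "\<dots> \<le> 400 * (real p ^ 5 * (divisor_bound (real p) * (1 + ln (real p)) ^ 3))"
    proof -
      have "divisor_bound (real p) \<ge> 0" by (simp add: divisor_bound_def)
      moreover have "harm p \<le> 1 + ln (real p)" using p_pos by (intro harm_le_1_plus_ln) auto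
      ultimately show ?thesis
        by (intro mult_left_mono power_mono) (auto simp: harm_nonneg)
    qed
    also have "\<dots> \<le> 400 * G p"
      unfolding G_def using Np(1) by (intro mult_left_mono) auto
    finally show ?thesis .
  qed
  \<comment> \<open>The primes below the threshold, among them 2, are finite in number. Adding their
    ratios \<open>L p / G p\<close> to 400 covers them, since \<open>G p\<close> is positive even
    where \<open>ln (ln p)\<close> is negative.\<close>
  define small where "small = {p. prime p \<and> real p < N}"
  have fin: "finite small"
    by (rule finite_subset[of _ "{..nat \<lceil>N\<rceil>}"]) (auto simp: small_def le_nat_iff, linarith)
  define C where "C = 400 + (\<Sum>p\<in>small. L p / G p)"
  have Gpos: "G p > 0" if "prime p" for p
    using that prime_gt_0_nat[of p] by (simp add: G_def)
  have L0: "L p \<ge> 0" for p by (simp add: L_def)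
  have sum0: "(\<Sum>p\<in>small. L p / G p) \<ge> 0"
    using L0 Gpos by (intro sum_nonneg divide_nonneg_nonneg) (auto simp: small_def less_imp_le)
  have "L p \<le> C * G p" if p: "prime p" for p
  proof (cases "real p \<ge> N")
    case True
    then have "L p \<le> 400 * G p" using large p by simp
    also have "\<dots> \<le> C * G p" using Gpos[OF p] sum0 by (intro mult_right_mono) (auto simp: C_def)
    finally show ?thesis .
  next
    case False
    then have "p \<in> small" using p by (simp add: small_def)
    then have "L p / G p \<le> (\<Sum>p\<in>small. L p / G p)"
      using L0 Gpos by (intro member_le_sum fin divide_nonneg_nonneg) (auto simp: small_def less_imp_le)
    then have "L p / G p \<le> C" by (simp add: C_def)
    then show ?thesis using Gpos[OF p] by (simp add: divide_le_eq)
  qed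
  moreover have "C > 0" using sum0 by (simp add: C_def)
  ultimately show ?thesis unfolding L_def G_def by blast
qed

end
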